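(* Let $\tau\in\mathbb{H}$, let $r\ge1$, let $k_1,\dots,k_r\ge2$ be integers, put $k=k_1+\cdots+k_r$, and let $m>0$ be an integer. Then \begin{align*} \sum_{i=1}^{r}\sum_{\substack{n_1,\dots,n_r\geq 0\\ n_1+\cdots+n_r=m+k}}&(-1)^{k_i+n_{i+1}+\cdots+n_r} \binom{n_i-1}{m}\prod_{\substack{j=1\\ j\neq i}}^{r}\binom{n_j-1}{k_j-1}\, \widetilde{G}_{n_{i-1},\dots,n_1}(\tau)\,\widetilde{G}_{n_{i+1},\dots,n_r}(\tau)\,G_{n_i}(\tau) \\ = \sum_{i=0}^{r}&\sum_{\substack{n_1,\dots,n_r\geq 0\\ n_1+\dots+n_r=m+k}} (-1)^{n_{i+1}+\cdots+n_r+m} \prod_{j=1}^{r}\binom{n_j-1}{k_j-1}\, \widetilde{G}_{n_{i},\dots,n_1}(\tau)\,\widetilde{G}_{n_{i+1},\dots,n_r}(\tau) \\ +& \sum_{i=1}^{r}\sum_{\substack{n_1,\dots,n_r\geq 0\\ n_1+\dots+n_r=m+k\\ n_i=0}} (-1)^{k_i+n_{i+1}+\cdots+n_{r}+m} \prod_{\substack{j=1\\ j\neq i}}^{r}\binom{n_j-1}{k_j-1}\, \widetilde{G}_{n_{i-1},\dots,n_1}(\tau)\,\widetilde{G}_{n_{i+1},\dots,n_r}(\tau). \end{align*}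
   Context: $\mathbb{H}$ is the upper half-plane, $\mathbb{Z}_N=\{n\in\mathbb{Z}: |n|<N\}$, and $\mathbb{Z}_M\tau+\mathbb{Z}_N=\{m\tau+n: m\in\mathbb{Z}_M, n\in\mathbb{Z}_N\}$. The order $\prec$ on $\mathbb{Z}\tau+\mathbb{Z}$: $m_1\tau+n_1\prec m_2\tau+n_2$ iff $m_1<m_2$, or $m_1=m_2$ and $n_1<n_2$. For integers $k_1,\dots,k_r\ge2$, $$\widetilde{G}_{k_1,\dots,k_r}(\tau)=\lim_{M\to\infty}\lim_{N\to\infty}\sum_{\substack{w_1,\dots,w_r\in\mathbb{Z}_M\tau+\mathbb{Z}_N\\ 0\prec w_1\prec\dots\prec w_r}}\frac{1}{w_1^{k_1}\cdots w_r^{k_r}},$$ $\widetilde{G}_\emptyset=1$, and for $k\ge2$, $G_k(\tau)=\lim_{M\to\infty}\lim_{N\to\infty}\sum_{(m,n)\in\mathbb{Z}_M\times\mathbb{Z}_N\setminus\{(0,0)\}}(m\tau+n)^{-k}$. Convention: a binomial coefficient $\binom{n-1}{l}$ with $n\ge0$ and $n-1<l$ ($l\ge1$) is $0$ (also for $n=0$), so terms in which $\widetilde{G}$ or $G$ would formally have an index entry less than $2$ do not occur. *)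

theory Defs
  imports Complex_Main
begin

definition ZZ :: "nat \<Rightarrow> int set" where
  "ZZ N = {n. \<bar>n\<bar> < int N}"

definition lattice_box :: "complex \<Rightarrow> nat \<Rightarrow> nat \<Rightarrow> complex set" where
  "lattice_box \<tau> M N = {of_int m * \<tau> + of_int n | m n. m \<in> ZZ M \<and> n \<in> ZZ N}"

text \<open>For \<open>Im \<tau> > 0\<close> the integers \<open>m\<close>, \<open>n\<close> in \<open>m * \<tau> + n\<close> are unique, so this is the
  lexicographic order on the lattice.\<close>

definition lattice_prec :: "complex \<Rightarrow> complex \<Rightarrow> complex \<Rightarrow> bool" where
  "lattice_prec \<tau> v w \<longleftrightarrow>
     (\<exists>m1 n1 m2 n2 :: int. v = of_int m1 * \<tau> + of_int n1 \<and> w = of_int m2 * \<tau> + of_int n2 \<and>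
        (m1 < m2 \<or> m1 = m2 \<and> n1 < n2))"

text \<open>A tuple \<open>w\<^sub>1 \<prec> \<dots> \<prec> w\<^sub>r\<close> of lattice points with \<open>0 \<prec> w\<^sub>1\<close> is a list \<open>ws\<close> of length \<open>r\<close>.\<close>

definition chains :: "complex \<Rightarrow> nat \<Rightarrow> nat \<Rightarrow> nat \<Rightarrow> complex list set" where
  "chains \<tau> r M N = {ws. length ws = r \<and> set ws \<subseteq> lattice_box \<tau> M N \<and>
                          sorted_wrt (lattice_prec \<tau>) (0 # ws)}"

text \<open>Both series below are iterated limits. \<open>lim\<close> is unspecified where a limit
  does not exist; for \<open>Im \<tau> > 0\<close> this concerns only index entries below 2.\<close>

definition multi_eisenstein :: "complex \<Rightarrow> nat list \<Rightarrow> complex" where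
  "multi_eisenstein \<tau> ks =
     lim (\<lambda>M. lim (\<lambda>N. \<Sum>ws\<in>chains \<tau> (length ks) M N. 1 / (\<Prod>j<length ks. (ws ! j) ^ (ks ! j))))"

definition eisenstein :: "complex \<Rightarrow> nat \<Rightarrow> complex" where
  "eisenstein \<tau> k =
     lim (\<lambda>M. lim (\<lambda>N. \<Sum>(m, n)\<in>ZZ M \<times> ZZ N - {(0, 0)}. 1 / (of_int m * \<tau> + of_int n) ^ k))"

lemma multi_eisenstein_Nil: "multi_eisenstein \<tau> [] = 1"
proof -
  have "chains \<tau> 0 M N = {[]}" for M N
    by (auto simp: chains_def)
  then show ?thesis
    by (simp add: multi_eisenstein_def)
qed

text \<open>The summation range \<open>n\<^sub>1 + \<dots> + n\<^sub>r = s\<close>, \<open>n\<^sub>j \<ge> 0\<close>.\<close>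

definition weak_compositions :: "nat \<Rightarrow> nat \<Rightarrow> nat list set" where
  "weak_compositions r s = {ns. length ns = r \<and> sum_list ns = s}"

lemma finite_weak_compositions: "finite (weak_compositions r s)"
proof (rule finite_subset)
  show "weak_compositions r s \<subseteq> {ns. set ns \<subseteq> {..s} \<and> length ns = r}"
    by (auto simp: weak_compositions_def intro: member_le_sum_list)
  show "finite {ns. set ns \<subseteq> {..s} \<and> length ns = r}"
    by (rule finite_lists_length_eq) simp
qed

text \<open>The binomial coefficient \<open>(n - 1 choose l)\<close>, used only for \<open>l \<ge> 1\<close>. Truncated
  subtraction makes it 0 for \<open>n = 0\<close>, as the convention requires.\<close>

definition binom1 :: "nat \<Rightarrow> nat \<Rightarrow> complex" where
  "binom1 n l = of_nat ((n - 1) choose l)"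

end

theory Submission
  imports Defs "HOL-Analysis.Uniform_Limit" "HOL-Library.Product_Plus"
begin

text \<open>
  Fix a chain \<open>w\<^sub>1 \<prec> \<dots> \<prec> w\<^sub>r\<close> of lattice points and consider the rational function
  \<open>z\<^sup>-\<^sup>m\<^sup>-\<^sup>1 \<Prod>\<^sub>j (w\<^sub>j - z) ^ (- k\<^sub>j)\<close>. It decays at least like \<open>1 / z\<^sup>2\<close> at infinity, so its residues add up
  to \<open>0\<close>. The residue at a point \<open>w\<^sub>i \<noteq> 0\<close> is a combination of products of the negative powers
  \<open>(w\<^sub>j - w\<^sub>i) ^ (- n\<^sub>j)\<close> and \<open>w\<^sub>i ^ (- n\<^sub>i)\<close>, with the binomial coefficients of the left-hand side. The residue
  at \<open>0\<close> is a combination of the products of the \<open>w\<^sub>j ^ (- n\<^sub>j)\<close> if \<open>0\<close> is not in the chain (first sum on the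
  right); if \<open>w\<^sub>i = 0\<close>, two poles merge, and what remains is a combination of products over \<open>j \<noteq> i\<close>
  (second sum on the right). This is \<open>residue_identity\<close>.

  Now add this up over all chains in the strip of the \<open>a * \<tau> + b\<close> with \<open>\<bar>a\<bar> < M\<close>. A chain with the
  prescribed member \<open>w\<^sub>i\<close> is a pair of independent chains of positive points, namely the differences
  \<open>w\<^sub>j - w\<^sub>i\<close> for \<open>j > i\<close>, and the differences \<open>w\<^sub>i - w\<^sub>j\<close> for \<open>j < i\<close> in the opposite order. So a sum over
  chains factors into truncated multiple Eisenstein series; the reversed index lists and the signs come from
  the reflection of the left part. Since \<open>b\<close> runs over all integers, the strip is invariant under
  horizontal translations, and the truncation depends only on the row of \<open>w\<^sub>i\<close>. This gives
  \<open>chain_sums_identity\<close>.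

  It remains to let \<open>M\<close> tend to infinity. All sums in a strip converge absolutely, but the sum
  over the whole lattice does not if an exponent is 2; there one uses that a single row, summed first,
  contributes \<open>O(1 / a\<^sup>2)\<close> (\<open>row_sum_bound\<close>, \<open>row_sum_decay\<close>). So the truncated multiple Eisenstein series
  converge (\<open>pos_sum_convergent\<close>), and Tannery's theorem disposes of the sum over the row of \<open>w\<^sub>i\<close>
  (\<open>row_convolution_tendsto\<close>).
\<close>

section \<open>The residues of a rational function add up to zero\<close>

text \<open>For \<open>c = p - a\<close> this is the expansion of \<open>(z - a) / (p - z)\<close> in \<open>X = z - a\<close>. The factor \<open>z - a\<close> makes it a power
  series in the case \<open>p = a\<close> too, where it is the constant \<open>-1\<close>. Hence the residue at \<open>a\<close> of a product of
  \<open>n\<close> functions \<open>1 / (p - z)\<close> is the coefficient of \<open>X ^ (n - 1)\<close> in the product of the series, whether or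
  not \<open>a\<close> is among the poles.\<close>
definition pole_series :: "'a::field \<Rightarrow> 'a fps" where
  "pole_series c = (if c = 0 then -1 else fps_X * inverse (fps_const c - fps_X))"

lemma pole_series_0 [simp]: "pole_series 0 = -1"
  by (simp add: pole_series_def)

lemma pole_series_mult_denominator:
  assumes "c \<noteq> 0"
  shows "pole_series c * (fps_const c - fps_X) = fps_X"
proof -
  have "inverse (fps_const c - fps_X) * (fps_const c - fps_X) = (1 :: 'a fps)"
    by (rule inverse_mult_eq_1) (use assms in simp)
  then show ?thesis
    using assms by (simp add: pole_series_def mult.assoc)
qed

text \<open>The partial fraction decomposition \<open>1 / ((p - z) * (q - z)) = (1 / (p - z) - 1 / (q - z)) / (q - p)\<close>,
  expanded at an arbitrary point.\<close>
lemma pole_series_resolvent: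
  fixes c d :: "'a :: field"
  assumes "c \<noteq> d"
  shows "fps_const (d - c) * (pole_series c * pole_series d)
           = fps_X * (pole_series c - pole_series d)"
proof -
  have *: "fps_const c * pole_series c = fps_X * pole_series c + fps_X" for c :: 'a
  proof (cases "c = 0")
    case False
    then show ?thesis
      using pole_series_mult_denominator[OF False] by (simp add: algebra_simps)
  qed simp
  have "fps_const (d - c) * (pole_series c * pole_series d)
      = (fps_const d * pole_series d) * pole_series c - (fps_const c * pole_series c) * pole_series d"
    by (simp add: algebra_simps flip: fps_const_sub)
  also have "\<dots> = fps_X * (pole_series c - pole_series d)"
    by (simp only: *) (simp add: algebra_simps)
  finally show ?thesis .
qed

lemma pole_series_power_nth:
  fixes c :: complex
  assumes "c \<noteq> 0" "k \<ge> 2"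
  shows "fps_nth (pole_series c ^ k) n = binom1 n (k - 1) / c ^ n"
proof -
  have eq: "fps_const c - fps_X = fps_const c * (1 - fps_const (1/c) * fps_X)"
    using assms by (simp add: algebra_simps flip: mult.assoc)
  have "inverse (fps_const c - fps_X) = fps_const (1/c) * inverse (1 - fps_const (1/c) * fps_X)"
    unfolding eq by (simp add: fps_inverse_mult fps_const_inverse divide_inverse)
  then have "pole_series c ^ k
      = fps_X ^ k * (fps_const ((1/c)^k) * inverse ((1 - fps_const (1/c) * fps_X) ^ k))"
    using assms by (simp add: pole_series_def power_mult_distrib fps_inverse_power
                              fps_const_power)
  also have "inverse ((1 - fps_const (1/c) * fps_X) ^ k)
      = Abs_fps (\<lambda>j. of_nat ((k + j - 1) choose j) * (1/c)^j)"
    by (rule one_minus_const_fps_X_neg_power') (use assms in simp)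
  finally have "fps_nth (pole_series c ^ k) n =
     (if n < k then 0 else (1/c)^k * (of_nat ((n - 1) choose (n - k)) * (1/c)^(n-k)))"
    by (simp add: fps_X_power_mult_nth)
  also have "\<dots> = binom1 n (k - 1) / c ^ n"
  proof (cases "n < k")
    case True
    then show ?thesis using assms by (auto simp: binom1_def)
  next
    case False
    then have "(n - 1) choose (n - k) = (n - 1) choose (k - 1)"
      using assms by (subst binomial_symmetric) auto
    moreover have "(1/c)^k * (1/c)^(n-k) = 1 / c^n"
      using False by (simp add: power_one_over flip: power_add)
    ultimately show ?thesis
      using False by (subst mult.left_commute) (simp add: binom1_def)
  qed
  finally show ?thesis .
qed

lemma minus_one_power_fps: "(-1) ^ n = fps_const ((-1) ^ n :: 'a :: comm_ring_1)"
  by (simp add: minus_one_power_iff flip: fps_const_neg)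

text \<open>The residue theorem for \<open>\<Prod>p\<in>P. 1 / (p - z)\<close>. If \<open>P\<close> has two distinct members \<open>p\<close> and \<open>q\<close>, the partial
  fraction decomposition reduces the claim to the functions without \<open>q\<close> and without \<open>p\<close>; their residue sums
  agree, being both \<open>-1\<close> when a single simple pole is left and both \<open>0\<close> by induction otherwise.
  If all members of \<open>P\<close> coincide, the only pole has order at least 2 and no residue.\<close>
lemma sum_residues_eq_0:
  fixes A :: "'a :: field set"
  assumes "finite A" "set_mset P \<subseteq> A" "size P \<ge> 2"
  shows "(\<Sum>a\<in>A. fps_nth (\<Prod>p\<in>#P. pole_series (p - a)) (size P - 1)) = 0"
  using assms(2,3)
proof (induction "size P" arbitrary: P rule: less_induct)
  case (less P)
  let ?F = "\<lambda>P a. (\<Prod>p\<in>#P. pole_series (p - a)) :: 'a fps"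
  let ?R = "\<lambda>P. \<Sum>a\<in>A. fps_nth (?F P a) (size P - 1)"
  obtain p P1 where P1: "P = add_mset p P1"
    using less.prems by (cases P) auto
  show ?case
  proof (cases "\<exists>q\<in>#P1. q \<noteq> p")
    case False
    then have P: "P = replicate_mset (size P) p"
      unfolding P1 by (metis set_mset_subset_singletonD replicate_mset_Suc singleton_iff
           size_add_mset subsetI)
    have "fps_nth (?F P a) (size P - 1) = 0" for a
    proof (cases "p = a")
      case True
      have "?F P a = fps_const ((-1) ^ size P)"
        by (subst P) (simp add: True minus_one_power_fps)
      then show ?thesis
        using less.prems by simp
    next
      case False
      have "?F P a = fps_X ^ size P * inverse (fps_const (p - a) - fps_X) ^ size P"
        by (subst P) (use False in \<open>simp add: pole_series_def power_mult_distrib\<close>)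
      then show ?thesis
        using less.prems by (auto simp: fps_X_power_mult_nth)
    qed
    then show ?thesis by simp
  next
    case True
    then obtain q where q: "q \<in># P1" "q \<noteq> p" by blast
    then obtain P2 where P2: "P1 = add_mset q P2" by (metis insert_DiffM)
    have sz: "size P = Suc (Suc (size P2))"
      by (simp add: P1 P2)
    have "(q - p) * fps_nth (?F P a) (size P - 1)
        = fps_nth (?F (add_mset p P2) a) (size P2) - fps_nth (?F (add_mset q P2) a) (size P2)" for a
    proof -
      have "fps_const (q - p) * ?F P a
          = (fps_const ((q - a) - (p - a)) * (pole_series (p - a) * pole_series (q - a))) * ?F P2 a"
        by (simp add: P1 P2 mult_ac)
      also have "\<dots> = fps_X * (?F (add_mset p P2) a - ?F (add_mset q P2) a)"
        by (subst pole_series_resolvent) (use q in \<open>auto simp: algebra_simps\<close>)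
      finally have "fps_nth (fps_const (q - p) * ?F P a) (Suc (size P2))
          = fps_nth (fps_X * (?F (add_mset p P2) a - ?F (add_mset q P2) a)) (Suc (size P2))"
        by simp
      then show ?thesis
        by (simp add: sz)
    qed
    then have "(q - p) * ?R P = ?R (add_mset p P2) - ?R (add_mset q P2)"
      by (simp add: sum_distrib_left sum_subtractf)
    moreover have "?R (add_mset p P2) = ?R (add_mset q P2)"
    proof (cases "P2 = {#}")
      case True
      have single: "(\<Sum>a\<in>A. fps_nth (pole_series (x - a)) 0) = -1" if "x \<in> A" for x :: 'a
      proof -
        have "(\<Sum>a\<in>A. fps_nth (pole_series (x - a)) 0) = (\<Sum>a\<in>A. if a = x then -1 else 0)"
          by (intro sum.cong) (auto simp: pole_series_def)
        then show ?thesis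
          using that assms(1) by simp
      qed
      have "p \<in> A" "q \<in> A"
        using less.prems by (auto simp: P1 P2)
      then show ?thesis
        using single by (simp add: True)
    next
      case False
      then have "size P2 \<ge> 1" by (simp add: Suc_le_eq flip: nonempty_has_size)
      then have "?R (add_mset x P2) = 0" if "x \<in># P" for x
        using less.prems that \<open>size P2 \<ge> 1\<close>
        by (intro less.hyps) (auto simp: P1 P2)
      then show ?thesis
        by (simp add: P1 P2)
    qed
    ultimately show ?thesis
      using q(2) by simp
  qed
qed

lemma fps_prod_lessThan_nth:
  fixes f :: "nat \<Rightarrow> 'a :: comm_ring_1 fps"
  assumes "r \<ge> 1"
  shows "fps_nth (\<Prod>j<r. f j) n
           = (\<Sum>ns\<in>weak_compositions r n. \<Prod>j<r. fps_nth (f j) (ns ! j))"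
proof -
  obtain s where s: "r = Suc s" using assms by (cases r) auto
  have "{0..s} = {..<r}" "natpermute n (s + 1) = weak_compositions r n"
    by (auto simp: s natpermute_def weak_compositions_def)
  then show ?thesis
    using fps_prod_nth[of f s n] by simp
qed

lemma prod_split_index:
  fixes f :: "nat \<Rightarrow> 'a :: comm_monoid_mult"
  assumes "i < r"
  shows "(\<Prod>j<r. f j) = f i * (\<Prod>j\<in>{..<r} - {i}. f j)"
  by (rule prod.remove) (use assms in auto)

text \<open>The case of a pole of order \<open>m + 1\<close> at \<open>0\<close> and poles of order \<open>k\<^sub>j\<close> at the \<open>w\<^sub>j\<close>. In the residue at \<open>w\<^sub>i\<close>
  the index \<open>n\<^sub>i\<close> belongs to the pole at \<open>0\<close>, since the pole at \<open>w\<^sub>i\<close> itself contributes only a sign. The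
  value \<open>0\<close> of division by zero makes the terms with \<open>w\<^sub>i = 0\<close> disappear from the left-hand
  side and from the first sum on the right.\<close>
lemma residue_identity:
  fixes ws :: "complex list" and ks :: "nat list"
  assumes r: "r \<ge> 1" and len: "length ks = r" "length ws = r"
    and ks: "\<forall>j<r. ks ! j \<ge> 2" and k: "k = (\<Sum>j<r. ks ! j)" and m: "m > 0"
    and dist: "distinct ws"
  shows "(\<Sum>i<r. \<Sum>ns\<in>weak_compositions r (m + k).
            (-1) ^ (ks ! i + ns ! i) * binom1 (ns ! i) m *
            (\<Prod>j\<in>{..<r} - {i}. binom1 (ns ! j) (ks ! j - 1)) *
            ((\<Prod>j\<in>{..<r} - {i}. 1 / (ws ! j - ws ! i) ^ (ns ! j)) / (ws ! i) ^ (ns ! i)))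
       = (-1) ^ m *
         ((\<Sum>ns\<in>weak_compositions r (m + k).
             (\<Prod>j<r. binom1 (ns ! j) (ks ! j - 1)) * (\<Prod>j<r. 1 / (ws ! j) ^ (ns ! j)))
        + (\<Sum>i<r. \<Sum>ns | ns \<in> weak_compositions r (m + k) \<and> ns ! i = 0.
             (-1) ^ (ks ! i) * (\<Prod>j\<in>{..<r} - {i}. binom1 (ns ! j) (ks ! j - 1)) *
             (if ws ! i = 0 then \<Prod>j\<in>{..<r} - {i}. 1 / (ws ! j) ^ (ns ! j) else 0)))"
    (is "(\<Sum>i<r. ?L i) = (-1) ^ m * (?R1 + (\<Sum>i<r. ?R2 i))")
proof -
  \<comment> \<open>The multiset of the poles. A zero among the \<open>ws\<close> raises the multiplicity of the pole at \<open>0\<close>.\<close>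
  define P where "P = (\<Sum>j<r. replicate_mset (ks ! j) (ws ! j)) + replicate_mset (Suc m) 0"
  define g where "g = (\<lambda>a. fps_nth (\<Prod>p\<in>#P. pole_series (p - a)) (m + k))"
  have size_P: "size P = Suc (m + k)"
    by (simp add: P_def k size_multiset_sum)
  have set_P: "set_mset P \<subseteq> insert 0 (set ws)"
    using len by (auto simp: P_def set_mset_sum split: if_splits)
  have prod_P: "(\<Prod>p\<in>#P. f p) = (\<Prod>j<r. f (ws ! j) ^ (ks ! j)) * f 0 ^ Suc m"
    for f :: "complex \<Rightarrow> complex fps"
  proof -
    have "(\<Prod>p\<in># (\<Sum>j\<in>J. replicate_mset (ks ! j) (ws ! j)). f p) = (\<Prod>j\<in>J. f (ws ! j) ^ (ks ! j))"
      if "finite J" for J using that by induction auto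
    then show ?thesis by (simp add: P_def mult_ac)
  qed
  have nz: "ws ! j - ws ! i \<noteq> 0" if "j < r" "i < r" "i \<noteq> j" for i j
    using dist that len by (simp add: nth_eq_iff_index_eq)
  have R2_0: "?R2 i = 0" if "ws ! i \<noteq> 0" for i
    using that by simp
  have "0 = (\<Sum>a\<in>insert 0 (set ws). fps_nth (\<Prod>p\<in>#P. pole_series (p - a)) (size P - 1))"
    by (rule sum_residues_eq_0[symmetric]) (use set_P size_P m in auto)
  also have "\<dots> = g 0 + sum g (set ws - {0})"
    by (simp add: g_def size_P sum.insert_remove)
  also have "sum g (set ws - {0}) = (\<Sum>w\<in>set ws. if w = 0 then 0 else g w)"
    by (intro sum.mono_neutral_cong_left) auto
  also have "\<dots> = (\<Sum>i<r. if ws ! i = 0 then 0 else g (ws ! i))"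
    by (rule sum.reindex_bij_betw[symmetric, where h = "nth ws"]) (use bij_betw_nth[OF dist] len in auto)
  also have "\<dots> = (\<Sum>i<r. ?L i)"
  proof (intro sum.cong refl)
    fix i assume "i \<in> {..<r}"
    then have i: "i < r" by simp
    show "(if ws ! i = 0 then 0 else g (ws ! i)) = ?L i"
    proof (cases "ws ! i = 0")
      case True
      have *: "binom1 n m = 0 \<or> (ws ! i) ^ n = 0" for n
        using m True by (cases n) (auto simp: binom1_def)
      then have "?L i = 0"
        by (intro sum.neutral ballI) (use * in force)
      then show ?thesis using True by simp
    next
      case False
      \<comment> \<open>At \<open>w\<^sub>i\<close> the pole of order \<open>k\<^sub>i\<close> contributes the constant \<open>(-1) ^ k\<^sub>i\<close>, so that the slot \<open>i\<close> is free for the pole at \<open>0\<close>.\<close>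
      define f where "f = (\<lambda>j. if j = i then pole_series (- ws ! i) ^ Suc m
                            else pole_series (ws ! j - ws ! i) ^ (ks ! j))"
      have "(\<Prod>p\<in>#P. pole_series (p - ws ! i))
          = (-1) ^ (ks ! i) * ((\<Prod>j\<in>{..<r} - {i}. f j) * pole_series (- ws ! i) ^ Suc m)"
        unfolding prod_P by (subst prod_split_index[OF i]) (simp add: f_def mult_ac)
      also have "\<dots> = fps_const ((-1) ^ (ks ! i)) * (\<Prod>j<r. f j)"
        by (subst prod_split_index[OF i, of f])
           (simp add: f_def mult_ac flip: fps_const_power fps_const_neg)
      finally have "g (ws ! i) = (-1) ^ (ks ! i) *
          (\<Sum>ns\<in>weak_compositions r (m + k). \<Prod>j<r. fps_nth (f j) (ns ! j))"
        by (simp only: g_def fps_mult_left_const_nth fps_prod_lessThan_nth[OF r])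
      also have "\<dots> = ?L i"
        unfolding sum_distrib_left
      proof (intro sum.cong refl)
        fix ns assume "ns \<in> weak_compositions r (m + k)"
        have "fps_nth (f i) (ns ! i) = (-1) ^ (ns ! i) * binom1 (ns ! i) m / (ws ! i) ^ (ns ! i)"
          unfolding f_def using False m
          by (simp only: if_True pole_series_power_nth refl)
             (subst pole_series_power_nth, auto simp: power_minus[of "ws ! i"] field_simps)
        moreover have "(\<Prod>j\<in>{..<r} - {i}. fps_nth (f j) (ns ! j))
            = (\<Prod>j\<in>{..<r} - {i}. binom1 (ns ! j) (ks ! j - 1) * (1 / (ws ! j - ws ! i) ^ (ns ! j)))"
          using ks nz i by (intro prod.cong refl) (auto simp: f_def pole_series_power_nth)
        ultimately show "(-1) ^ (ks ! i) * (\<Prod>j<r. fps_nth (f j) (ns ! j)) =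
            (-1) ^ (ks ! i + ns ! i) * binom1 (ns ! i) m *
            (\<Prod>j\<in>{..<r} - {i}. binom1 (ns ! j) (ks ! j - 1)) *
            ((\<Prod>j\<in>{..<r} - {i}. 1 / (ws ! j - ws ! i) ^ (ns ! j)) / (ws ! i) ^ (ns ! i))"
          by (simp only: prod_split_index[OF i] prod.distrib power_add) (simp add: mult_ac)
      qed
      finally show ?thesis using False by simp
    qed
  qed
  finally have *: "g 0 + (\<Sum>i<r. ?L i) = 0" by simp
  have "g 0 = (-1) ^ Suc m * (?R1 + (\<Sum>i<r. ?R2 i))"
  proof (cases "0 \<in> set ws")
    case False
    then have nz0: "ws ! j \<noteq> 0" if "j < r" for j
      using that len by (metis nth_mem)
    have "(\<Sum>i<r. ?R2 i) = 0"
      using nz0 by (intro sum.neutral) auto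
    moreover have "g 0 = (-1) ^ Suc m * ?R1"
    proof -
      have "(\<Prod>p\<in>#P. pole_series (p - 0)) = fps_const ((-1) ^ Suc m) * (\<Prod>j<r. pole_series (ws ! j) ^ (ks ! j))"
        unfolding prod_P by (simp add: mult_ac flip: fps_const_power fps_const_neg)
      then have "g 0 = (-1) ^ Suc m * (\<Sum>ns\<in>weak_compositions r (m + k).
                   \<Prod>j<r. fps_nth (pole_series (ws ! j) ^ (ks ! j)) (ns ! j))"
        by (simp only: g_def fps_mult_left_const_nth fps_prod_lessThan_nth[OF r])
      also have "(\<Sum>ns\<in>weak_compositions r (m + k).
                   \<Prod>j<r. fps_nth (pole_series (ws ! j) ^ (ks ! j)) (ns ! j)) = ?R1"
        unfolding prod.distrib[symmetric] using ks nz0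
        by (intro sum.cong prod.cong refl) (auto simp: pole_series_power_nth)
      finally show ?thesis .
    qed
    ultimately show ?thesis by simp
  next
    case True
    then obtain i where i: "i < r" "ws ! i = 0"
      using len by (metis in_set_conv_nth)
    have nz0: "ws ! j \<noteq> 0" if "j < r" "j \<noteq> i" for j
      using nz[of j i] that i by simp
    have "?R1 = 0"
    proof (intro sum.neutral ballI)
      fix ns :: "nat list"
      have "binom1 (ns ! i) (ks ! i - 1) * (1 / (ws ! i) ^ (ns ! i)) = 0"
        using ks i by (cases "ns ! i") (auto simp: binom1_def)
      then show "(\<Prod>j<r. binom1 (ns ! j) (ks ! j - 1)) * (\<Prod>j<r. 1 / (ws ! j) ^ (ns ! j)) = 0"
        unfolding prod.distrib[symmetric] using i by (intro prod_zero) auto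
    qed
    moreover have "(\<Sum>i<r. ?R2 i) = ?R2 i"
    proof -
      have "(\<Sum>i<r. ?R2 i) = (\<Sum>j<r. if j = i then ?R2 i else 0)"
        using nz0 by (intro sum.cong refl) auto
      then show ?thesis using i by simp
    qed
    moreover have "g 0 = (-1) ^ Suc m * ?R2 i"
    proof -
      \<comment> \<open>The constant series 1 in the slot \<open>i\<close> selects the compositions with \<open>n\<^sub>i = 0\<close>.\<close>
      define f where "f = (\<lambda>j. if j = i then 1 else pole_series (ws ! j) ^ (ks ! j))"
      have "(\<Prod>p\<in>#P. pole_series (p - 0))
          = (-1) ^ Suc m * ((-1) ^ (ks ! i) * (\<Prod>j\<in>{..<r} - {i}. f j))"
        unfolding prod_P by (subst prod_split_index[OF i(1)]) (simp add: f_def mult_ac i)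
      also have "(\<Prod>j\<in>{..<r} - {i}. f j) = (\<Prod>j<r. f j)"
        by (subst prod_split_index[OF i(1), of f]) (simp add: f_def)
      also have "(-1) ^ Suc m * ((-1) ^ (ks ! i) * (\<Prod>j<r. f j))
          = fps_const ((-1) ^ Suc m * (-1) ^ (ks ! i)) * (\<Prod>j<r. f j)"
        by (simp add: mult_ac flip: fps_const_power fps_const_neg fps_const_mult)
      finally have "g 0 = (-1) ^ Suc m * (-1) ^ (ks ! i) *
          (\<Sum>ns\<in>weak_compositions r (m + k). \<Prod>j<r. fps_nth (f j) (ns ! j))"
        by (simp only: g_def fps_mult_left_const_nth fps_prod_lessThan_nth[OF r])
      also have "(\<Sum>ns\<in>weak_compositions r (m + k). \<Prod>j<r. fps_nth (f j) (ns ! j))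
          = (\<Sum>ns | ns \<in> weak_compositions r (m + k) \<and> ns ! i = 0.
               (\<Prod>j\<in>{..<r} - {i}. binom1 (ns ! j) (ks ! j - 1)) *
               (\<Prod>j\<in>{..<r} - {i}. 1 / (ws ! j) ^ (ns ! j)))"
      proof (rule sum.mono_neutral_cong_right[OF finite_weak_compositions], goal_cases)
        case 2
        then show ?case
          by (auto simp: prod_split_index[OF i(1)] f_def)
      next
        case (3 ns)
        then have "fps_nth (f i) (ns ! i) = 1" by (simp add: f_def)
        moreover have "(\<Prod>j\<in>{..<r} - {i}. fps_nth (f j) (ns ! j))
            = (\<Prod>j\<in>{..<r} - {i}. binom1 (ns ! j) (ks ! j - 1) * (1 / (ws ! j) ^ (ns ! j)))"
          using ks nz0 by (intro prod.cong refl) (auto simp: f_def pole_series_power_nth)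
        ultimately show ?case
          by (simp only: prod_split_index[OF i(1)] prod.distrib) simp
      qed auto
      also have "(-1) ^ Suc m * (-1) ^ (ks ! i) * \<dots> = (-1) ^ Suc m * ?R2 i"
        using i by (simp add: sum_distrib_left mult_ac)
      finally show ?thesis .
    qed
    ultimately show ?thesis by simp
  qed
  with * show ?thesis
    by (simp add: add_eq_0_iff2)
qed

section \<open>Infinite sums\<close>

lemma has_sum_times:
  fixes f :: "'a \<Rightarrow> 'c :: {banach, real_normed_algebra}" and g :: "'b \<Rightarrow> 'c"
  assumes "(\<lambda>x. norm (f x)) summable_on A" "(\<lambda>y. norm (g y)) summable_on B"
    and "(f has_sum F) A" "(g has_sum G) B"
  shows "((\<lambda>(x, y). f x * g y) has_sum (F * G)) (A \<times> B)"
proof (rule has_sum_SigmaI)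
  show "((\<lambda>y. case (x, y) of (x, y) \<Rightarrow> f x * g y) has_sum (f x * G)) B" for x
    using has_sum_cmult_right[OF assms(4)] by simp
  show "((\<lambda>x. f x * G) has_sum (F * G)) A"
    by (rule has_sum_cmult_left) fact
  have "(\<lambda>(x, y). norm (f x) * norm (g y)) summable_on (A \<times> B)"
  proof (rule summable_on_SigmaI)
    show "((\<lambda>y. case (x, y) of (x, y) \<Rightarrow> norm (f x) * norm (g y)) has_sum
            (norm (f x) * (\<Sum>\<^sub>\<infinity>y\<in>B. norm (g y)))) B" for x
      using has_sum_cmult_right[OF has_sum_infsum[OF assms(2)]] by simp
    show "(\<lambda>x. norm (f x) * (\<Sum>\<^sub>\<infinity>y\<in>B. norm (g y))) summable_on A"
      by (rule summable_on_cmult_left) fact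
  qed auto
  then have "(\<lambda>p. norm (case p of (x, y) \<Rightarrow> f x * g y)) summable_on (A \<times> B)"
    by (rule abs_summable_on_comparison_test') (auto simp: norm_mult_ineq)
  then show "(\<lambda>(x, y). f x * g y) summable_on (A \<times> B)"
    by (rule abs_summable_summable)
qed

lemma has_sum_sum:
  fixes f :: "'i \<Rightarrow> 'a \<Rightarrow> 'b :: topological_comm_monoid_add"
  assumes "\<And>i. i \<in> I \<Longrightarrow> (f i has_sum s i) A"
  shows "((\<lambda>x. \<Sum>i\<in>I. f i x) has_sum (\<Sum>i\<in>I. s i)) A"
  using assms by (induction I rule: infinite_finite_induct) (auto intro!: has_sum_add)

text \<open>A sum over all lists of fixed length factors, because the entries are chosen independently. Chains
  form a subset of such lists, so this supplies majorants for sums over chains.\<close>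
lemma has_sum_prod_list_zip:
  fixes g :: "'k \<Rightarrow> 'a \<Rightarrow> real"
  assumes "\<And>k x. g k x \<ge> 0" and "\<And>k. k \<in> set ks \<Longrightarrow> (g k has_sum G k) A"
  shows "((\<lambda>xs. \<Prod>(k, x)\<leftarrow>zip ks xs. g k x) has_sum (\<Prod>k\<leftarrow>ks. G k))
           {xs. length xs = length ks \<and> set xs \<subseteq> A}"
  using assms(2)
proof (induction ks)
  case Nil
  have "{xs. length xs = length [] \<and> set xs \<subseteq> A} = {[]}" by auto
  then show ?case by (simp add: has_sum_finiteI)
next
  case (Cons k ks)
  let ?L = "\<lambda>ks::'k list. {xs. length xs = length ks \<and> set xs \<subseteq> A}"
  let ?f = "\<lambda>ks xs. \<Prod>(k, x)\<leftarrow>zip ks xs. g k x"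
  have nonneg: "?f js xs \<ge> 0" for js xs
    by (rule prod_list_nonneg) (use assms(1) in auto)
  have IH: "(?f ks has_sum (\<Prod>k\<leftarrow>ks. G k)) (?L ks)"
    by (rule Cons.IH) (use Cons.prems in auto)
  have gk: "(g k has_sum G k) A"
    using Cons.prems by simp
  have "((\<lambda>(x, xs). g k x * ?f ks xs) has_sum (G k * (\<Prod>k\<leftarrow>ks. G k))) (A \<times> ?L ks)"
    by (rule has_sum_times)
       (use gk IH assms(1) nonneg in \<open>auto intro: has_sum_imp_summable\<close>)
  also have "?this \<longleftrightarrow> (?f (k # ks) has_sum (G k * (\<Prod>k\<leftarrow>ks. G k))) (?L (k # ks))"
  proof (rule has_sum_reindex_bij_witness[where j = "\<lambda>(x, xs). x # xs" and i = "\<lambda>xs. (hd xs, tl xs)"])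
    fix xs assume "xs \<in> ?L (k # ks)"
    then show "(case (hd xs, tl xs) of (x, xs) \<Rightarrow> x # xs) = xs" "(hd xs, tl xs) \<in> A \<times> ?L ks"
      by (cases xs; auto)+
  qed auto
  finally show ?case by simp
qed

text \<open>Connects the limits over boxes in the definition of Eisenstein series with unordered sums.\<close>
lemma has_sum_imp_tendsto_exhaustion:
  assumes "(f has_sum s) A" and "\<And>n. finite (F n)" "\<And>n. F n \<subseteq> A"
    and "\<And>x. x \<in> A \<Longrightarrow> eventually (\<lambda>n. x \<in> F n) at_top"
  shows "(\<lambda>n. sum f (F n)) \<longlonglongrightarrow> s"
proof -
  have "filterlim F (finite_subsets_at_top A) at_top"
    unfolding filterlim_finite_subsets_at_top
  proof safe
    fix X assume X: "finite X" "X \<subseteq> A"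
    then have "eventually (\<lambda>n. \<forall>x\<in>X. x \<in> F n) at_top"
      using assms(4) by (intro eventually_ball_finite) auto
    then show "eventually (\<lambda>n. finite (F n) \<and> X \<subseteq> F n \<and> F n \<subseteq> A) at_top"
      by eventually_elim (use assms(2,3) in blast)
  qed
  then show ?thesis
    using assms(1) unfolding has_sum_def by (rule filterlim_compose[rotated])
qed

text \<open>Tannery's theorem for a sum over the integers, where the terms outside a growing symmetric interval
  are cut off. The theorem for series over the natural numbers applies after enumerating the integers.\<close>
lemma tannery_symmetric_int:
  fixes T :: "int \<Rightarrow> complex" and f :: "nat \<Rightarrow> int \<Rightarrow> complex"
  assumes T: "(\<lambda>a. norm (T a)) summable_on UNIV"
    and lim: "\<And>a. (\<lambda>M. f M a) \<longlonglongrightarrow> c"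
    and bound: "\<And>M a. norm (f M a) \<le> B"
  shows "(\<lambda>M. \<Sum>a | \<bar>a\<bar> < int M. T a * f M a) \<longlonglongrightarrow> (\<Sum>\<^sub>\<infinity>a. T a) * c"
proof -
  have bij: "bij_betw int_decode UNIV UNIV"
    by (rule bij_int_decode)
  define h where "h = (\<lambda>n M. if \<bar>int_decode n\<bar> < int M then T (int_decode n) * f M (int_decode n) else 0)"
  have "summable (\<lambda>n. norm (T (int_decode n)))"
    using T summable_on_reindex_bij_betw[OF bij, of "\<lambda>a. norm (T a)"]
    by (intro summable_on_imp_summable) simp
  then have summable: "summable (\<lambda>n. norm (T (int_decode n)) * B)"
    by (rule summable_mult2)
  have "B \<ge> 0"
    using bound[of 0 0] norm_ge_zero order_trans by blast
  have "(\<lambda>M. \<Sum>n. h n M) \<longlonglongrightarrow> (\<Sum>n. T (int_decode n) * c)"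
  proof (rule tannerys_theorem[THEN conjunct2, THEN conjunct2])
    fix n
    have "eventually (\<lambda>M. h n M = T (int_decode n) * f M (int_decode n)) at_top"
      using eventually_gt_at_top[of "nat \<bar>int_decode n\<bar>"]
      by eventually_elim (auto simp: h_def)
    moreover have "(\<lambda>M. T (int_decode n) * f M (int_decode n)) \<longlonglongrightarrow> T (int_decode n) * c"
      by (intro tendsto_intros lim)
    ultimately show "(\<lambda>M. h n M) \<longlonglongrightarrow> T (int_decode n) * c"
      by (simp add: tendsto_cong)
  next
    show "eventually (\<lambda>(n, M). norm (h n M) \<le> norm (T (int_decode n)) * B) (at_top \<times>\<^sub>F at_top)"
      using bound \<open>B \<ge> 0\<close>
      by (intro always_eventually) (auto simp: h_def norm_mult intro!: mult_left_mono)
  qed (use summable in auto)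
  moreover have "(\<Sum>n. h n M) = (\<Sum>a | \<bar>a\<bar> < int M. T a * f M a)" for M
  proof -
    have fin: "finite {a. \<bar>a\<bar> < int M}"
      by (rule finite_subset[of _ "{- int M..int M}"]) auto
    have "((\<lambda>a. if \<bar>a\<bar> < int M then T a * f M a else 0) has_sum
             (\<Sum>a | \<bar>a\<bar> < int M. T a * f M a)) UNIV"
      by (rule has_sum_finite_neutralI[of "{a. \<bar>a\<bar> < int M}"]) (use fin in auto)
    then have "((\<lambda>n. h n M) has_sum (\<Sum>a | \<bar>a\<bar> < int M. T a * f M a)) UNIV"
      unfolding h_def by (subst has_sum_reindex_bij_betw[OF bij])
    then show ?thesis
      using has_sum_imp_sums sums_unique by metis
  qed
  moreover have "(\<Sum>n. T (int_decode n) * c) = (\<Sum>\<^sub>\<infinity>a. T a) * c"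
  proof -
    have "(T has_sum (\<Sum>\<^sub>\<infinity>a. T a)) UNIV"
      by (rule has_sum_infsum[OF abs_summable_summable[OF T]])
    then have "((\<lambda>n. T (int_decode n) * c) has_sum (\<Sum>\<^sub>\<infinity>a. T a) * c) UNIV"
      by (intro has_sum_cmult_left) (subst has_sum_reindex_bij_betw[OF bij])
    then show ?thesis
      using has_sum_imp_sums sums_unique by metis
  qed
  ultimately show ?thesis by simp
qed

section \<open>Sums over one row of the lattice\<close>

text \<open>A telescoping majorant: with \<open>s = n + h\<close> one has \<open>s * (s + 1) \<le> (1 + 1 / h) * s\<^sup>2\<close> and
  \<open>s\<^sup>2 \<le> 2 * (n\<^sup>2 + h\<^sup>2)\<close>.\<close>
lemma sums_inverse_square_bound:
  fixes h :: real
  assumes "h > 0"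
  shows "(\<lambda>n. 2 * (1 + 1 / h) * (1 / (real n + h) - 1 / (real (Suc n) + h))) sums (2 * (1 + 1 / h) / h)"
    and "1 / (real n ^ 2 + h ^ 2) \<le> 2 * (1 + 1 / h) * (1 / (real n + h) - 1 / (real (Suc n) + h))"
proof -
  have "(\<lambda>n. 1 / (real n + h)) \<longlonglongrightarrow> 0"
    by (subst add.commute, intro tendsto_divide_0[OF tendsto_const] filterlim_at_top_imp_at_infinity
          filterlim_tendsto_add_at_top[OF tendsto_const] filterlim_real_sequentially)
  then have "(\<lambda>n. 1 / (real n + h) - 1 / (real (Suc n) + h)) sums (1 / (real 0 + h) - 0)"
    by (rule telescope_sums')
  from sums_mult[OF this, of "2 * (1 + 1/h)"]
  show "(\<lambda>n. 2 * (1 + 1 / h) * (1 / (real n + h) - 1 / (real (Suc n) + h))) sums (2 * (1 + 1 / h) / h)"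
    by simp
  define s where "s = real n + h"
  have s: "s \<ge> h" "s > 0" using assms by (auto simp: s_def)
  have "s * (s + 1) \<le> s ^ 2 * (1 + 1 / h)"
  proof -
    have "s * 1 \<le> s * (s / h)"
      using s assms by (intro mult_left_mono) (auto simp: field_simps)
    then show ?thesis by (simp add: power2_eq_square algebra_simps)
  qed
  also have "s ^ 2 \<le> 2 * (real n ^ 2 + h ^ 2)"
    using sum_squares_bound[of "real n" h] by (simp add: s_def power2_sum)
  finally have le: "s * (s + 1) \<le> 2 * (real n ^ 2 + h ^ 2) * (1 + 1 / h)"
    using assms by (auto simp: mult_right_mono)
  have "0 < real n ^ 2 + h ^ 2"
    using assms by (simp add: add_nonneg_pos)
  moreover have frac: "1 / x \<le> c / y" if "0 < x" "0 < y" "y \<le> c * x" for x y c :: real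
    using that by (simp add: pos_divide_le_eq pos_le_divide_eq)
  moreover have "2 * (real n ^ 2 + h ^ 2) * (1 + 1 / h) = 2 * (1 + 1 / h) * (real n ^ 2 + h ^ 2)"
    by (simp only: mult_ac)
  ultimately have "1 / (real n ^ 2 + h ^ 2) \<le> 2 * (1 + 1 / h) / (s * (s + 1))"
    using le s by (intro frac) auto
  also have "1 / s - 1 / (s + 1) = 1 / (s * (s + 1))"
    using s by (simp add: divide_simps)
  then have "2 * (1 + 1 / h) / (s * (s + 1)) = 2 * (1 + 1 / h) * (1 / s - 1 / (s + 1))"
    by simp
  finally show "1 / (real n ^ 2 + h ^ 2) \<le> 2 * (1 + 1 / h) * (1 / (real n + h) - 1 / (real (Suc n) + h))"
    by (simp add: s_def add_ac)
qed

text \<open>Shifting the row by an integer moves the real part of \<open>z\<close> into \<open>[0, 1)\<close>. Then the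
  \<open>n\<close>-th point on either side of the imaginary axis (\<open>n = 0, 1, 2, \<dots>\<close>) is at distance at least \<open>sqrt (n\<^sup>2 + h\<^sup>2)\<close>
  from the origin, and the previous bound applies to either half.\<close>
lemma row_sum_inverse_square:
  fixes z :: complex
  assumes "Im z \<noteq> 0"
  defines "h \<equiv> \<bar>Im z\<bar>"
  shows "(\<lambda>b::int. 1 / norm (z + of_int b) ^ 2) summable_on UNIV"
    and "(\<Sum>\<^sub>\<infinity>b::int. 1 / norm (z + of_int b) ^ 2) \<le> 4 * (1 + 1 / h) / h"
proof -
  have h: "h > 0" using assms by simp
  define q where "q = (\<lambda>n::nat. 1 / (real n ^ 2 + h ^ 2))"
  define d where "d = (\<lambda>n::nat. 2 * (1 + 1 / h) * (1 / (real n + h) - 1 / (real (Suc n) + h)))"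
  have qd: "q n \<le> d n" and q0: "0 \<le> q n" for n
    using sums_inverse_square_bound(2)[OF h, of n] by (auto simp: q_def d_def)
  have d: "d sums (2 * (1 + 1 / h) / h)"
    unfolding d_def by (rule sums_inverse_square_bound(1)[OF h])
  have sq: "summable q"
    using d qd q0 by (intro summable_comparison_test[OF _ sums_summable[OF d]]) auto
  have Q: "suminf q \<le> 2 * (1 + 1 / h) / h"
    using suminf_le[OF qd sq sums_summable[OF d]] sums_unique[OF d] by simp
  have q_sum: "(q has_sum suminf q) UNIV"
    using sq q0 by (intro sums_nonneg_imp_has_sum) (auto simp: summable_sums)
  define f where "f = (\<lambda>b::int. 1 / norm (z + of_int b) ^ 2)"
  define t where "t = \<lfloor>Re z\<rfloor>"
  define u where "u = Re z - of_int t"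
  have u: "0 \<le> u" "u < 1" unfolding u_def t_def by linarith+
  have f_shift: "f (b - t) = 1 / ((u + of_int b) ^ 2 + h ^ 2)" for b
    by (simp add: f_def cmod_power2 u_def h_def algebra_simps)
  have half: "(\<lambda>n::nat. f (c n - t)) summable_on UNIV \<and> (\<Sum>\<^sub>\<infinity>n. f (c n - t)) \<le> suminf q"
    if c: "\<And>n. real n ^ 2 \<le> (u + of_int (c n)) ^ 2" for c :: "nat \<Rightarrow> int"
  proof -
    have le: "f (c n - t) \<le> q n" for n
      unfolding f_shift q_def using c[of n] h
      by (intro divide_left_mono mult_pos_pos) (auto intro: add_nonneg_pos)
    have "(\<lambda>n. f (c n - t)) summable_on UNIV"
      by (rule summable_on_comparison_test[OF has_sum_imp_summable[OF q_sum]])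
         (use le in \<open>auto simp: f_def\<close>)
    then show ?thesis
      using infsum_mono[OF _ has_sum_imp_summable[OF q_sum], of "\<lambda>n. f (c n - t)"] le
        infsumI[OF q_sum] by auto
  qed
  have 1: "real n ^ 2 \<le> (u + of_int (int n)) ^ 2" for n
    using u by (intro power_mono) auto
  have 2: "real n ^ 2 \<le> (u + of_int (- 1 - int n)) ^ 2" for n
  proof -
    have "real n ^ 2 \<le> (1 + real n - u) ^ 2" using u by (intro power_mono) auto
    also have "\<dots> = (u + of_int (- 1 - int n)) ^ 2" by (simp add: power2_eq_square algebra_simps)
    finally show ?thesis .
  qed
  have bij1: "bij_betw (\<lambda>n. int n - t) UNIV {- t..}"
    by (rule bij_betwI[where g = "\<lambda>b. nat (b + t)"]) auto
  have bij2: "bij_betw (\<lambda>n. (- 1 - int n) - t) UNIV {..<- t}"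
    by (rule bij_betwI[where g = "\<lambda>b. nat (- 1 - (b + t))"]) auto
  have U: "{- t..} \<union> {..<- t} = UNIV" "{- t..} \<inter> {..<- t} = {}" by auto
  note h1 = half[of int, OF 1] and h2 = half[of "\<lambda>n. - 1 - int n", OF 2]
  have s1: "f summable_on {- t..}" "infsum f {- t..} \<le> suminf q"
    using h1 summable_on_reindex_bij_betw[OF bij1, of f] infsum_reindex_bij_betw[OF bij1, of f] by auto
  have s2: "f summable_on {..<- t}" "infsum f {..<- t} \<le> suminf q"
    using h2 summable_on_reindex_bij_betw[OF bij2, of f] infsum_reindex_bij_betw[OF bij2, of f] by auto
  show "f summable_on UNIV"
    using summable_on_Un_disjoint[OF s1(1) s2(1)] U by simp
  have "infsum f UNIV = infsum f {- t..} + infsum f {..<- t}"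
    using infsum_Un_disjoint[OF s1(1) s2(1)] U by simp
  also have "\<dots> \<le> 2 * (2 * (1 + 1 / h) / h)"
    using s1(2) s2(2) Q by linarith
  finally show "infsum f UNIV \<le> 4 * (1 + 1 / h) / h"
    by simp
qed

lemma row_inverse_power_le:
  fixes z :: complex
  assumes "Im z \<noteq> 0" "k \<ge> 2"
  shows "norm (1 / (z + of_int b) ^ k) \<le> 1 / \<bar>Im z\<bar> ^ (k - 2) * (1 / norm (z + of_int b) ^ 2)"
proof -
  have le: "\<bar>Im z\<bar> \<le> norm (z + of_int b)"
    using abs_Im_le_cmod[of "z + of_int b"] by simp
  then have pos: "norm (z + of_int b) > 0"
    using assms by linarith
  have "norm (1 / (z + of_int b) ^ k) = 1 / norm (z + of_int b) ^ (k - 2) * (1 / norm (z + of_int b) ^ 2)"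
  proof -
    obtain j where "k = j + 2" using assms by (metis le_add_diff_inverse2)
    then show ?thesis by (simp add: norm_divide norm_mult norm_power power_add power2_eq_square)
  qed
  also have "\<dots> \<le> 1 / \<bar>Im z\<bar> ^ (k - 2) * (1 / norm (z + of_int b) ^ 2)"
    using le pos assms by (intro mult_right_mono divide_left_mono power_mono mult_pos_pos) auto
  finally show ?thesis .
qed

lemma row_abs_summable:
  fixes z :: complex
  assumes "Im z \<noteq> 0" "k \<ge> 2"
  shows "(\<lambda>b::int. norm (1 / (z + of_int b) ^ k)) summable_on UNIV"
    and "(\<Sum>\<^sub>\<infinity>b::int. norm (1 / (z + of_int b) ^ k))
           \<le> 1 / \<bar>Im z\<bar> ^ (k - 2) * (4 * (1 + 1 / \<bar>Im z\<bar>) / \<bar>Im z\<bar>)"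
proof -
  let ?c = "1 / \<bar>Im z\<bar> ^ (k - 2)"
  let ?g = "\<lambda>b::int. ?c * (1 / norm (z + of_int b) ^ 2)"
  note sq = row_sum_inverse_square[OF assms(1)]
  have g: "?g summable_on UNIV"
    by (rule summable_on_cmult_right[OF sq(1)])
  show s: "(\<lambda>b::int. norm (1 / (z + of_int b) ^ k)) summable_on UNIV"
    by (rule summable_on_comparison_test[OF g row_inverse_power_le[OF assms]]) auto
  have "(\<Sum>\<^sub>\<infinity>b::int. norm (1 / (z + of_int b) ^ k)) \<le> infsum ?g UNIV"
    by (rule infsum_mono[OF s g row_inverse_power_le[OF assms]])
  also have "\<dots> = ?c * (\<Sum>\<^sub>\<infinity>b::int. 1 / norm (z + of_int b) ^ 2)"
    by (rule infsum_cmult_right) (use sq in auto)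
  also have "\<dots> \<le> ?c * (4 * (1 + 1 / \<bar>Im z\<bar>) / \<bar>Im z\<bar>)"
    by (intro mult_left_mono sq(2)) auto
  finally show "(\<Sum>\<^sub>\<infinity>b::int. norm (1 / (z + of_int b) ^ k)) \<le> \<dots>" .
qed

text \<open>The terms are the differences \<open>1 / (z + b) - 1 / (z + b + 1)\<close>.\<close>
lemma row_telescope:
  fixes z :: complex
  assumes "Im z \<noteq> 0"
  shows "((\<lambda>b::int. 1 / ((z + of_int b) * (z + of_int (b + 1)))) has_sum 0) UNIV"
proof -
  let ?f = "\<lambda>b::int. 1 / ((z + of_int b) * (z + of_int (b + 1)))"
  have nz: "z + of_int b \<noteq> 0" for b
    using assms by (auto simp: complex_eq_iff)
  have "(\<lambda>b::int. 1 / norm (z + of_int b) ^ 2 + 1 / norm ((z + 1) + of_int b) ^ 2) summable_on UNIV"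
    using assms by (intro summable_on_add row_sum_inverse_square(1)) auto
  then have "(\<lambda>b. norm (?f b)) summable_on UNIV"
  proof (rule abs_summable_on_comparison_test')
    have le: "x * y \<le> x ^ 2 + y ^ 2" if "0 \<le> x" "0 \<le> y" for x y :: real
      using sum_squares_bound[of x y] mult_nonneg_nonneg[OF that] by linarith
    fix b :: int
    have "norm (?f b) = (1 / norm (z + of_int b)) * (1 / norm ((z + 1) + of_int b))"
      by (simp add: norm_divide norm_mult add_ac)
    also have "\<dots> \<le> (1 / norm (z + of_int b)) ^ 2 + (1 / norm ((z + 1) + of_int b)) ^ 2"
      by (rule le) auto
    finally show "norm (?f b) \<le> 1 / norm (z + of_int b) ^ 2 + 1 / norm ((z + 1) + of_int b) ^ 2"
      by (simp add: power_divide)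
  qed
  then have summable: "?f summable_on UNIV"
    by (rule abs_summable_summable)
  have "(\<lambda>n. sum ?f {- int n..<int n}) \<longlonglongrightarrow> infsum ?f UNIV"
  proof (rule has_sum_imp_tendsto_exhaustion[OF has_sum_infsum[OF summable]])
    show "eventually (\<lambda>n. b \<in> {- int n..<int n}) at_top" for b
      using eventually_gt_at_top[of "nat \<bar>b\<bar>"] by eventually_elim auto
  qed auto
  moreover have "sum ?f {- int n..<int n} = 1 / (z - of_nat n) - 1 / (z + of_nat n)" for n
  proof -
    have "sum ?f {a..<a + int j} = 1 / (z + of_int a) - 1 / (z + of_int (a + int j))" for a j
    proof (induction j)
      case (Suc j)
      have "{a..<a + int (Suc j)} = insert (a + int j) {a..<a + int j}" by auto
      moreover have "?f b = 1 / (z + of_int b) - 1 / (z + of_int (b + 1))" for b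
        using nz[of b] nz[of "b + 1"] by (simp add: divide_simps)
      from this[of "a + int j"]
      have "?f (a + int j) = 1 / (z + of_int (a + int j)) - 1 / (z + of_int (a + int (Suc j)))"
        by (simp only: of_nat_Suc add_ac)
      ultimately show ?case using Suc by simp
    qed simp
    from this[of "- int n" "2 * n"] show ?thesis by simp
  qed
  moreover have "(\<lambda>n. 1 / (z - of_nat n) - 1 / (z + of_nat n)) \<longlonglongrightarrow> 0"
  proof -
    have 1: "filterlim (\<lambda>n. z + of_nat n) at_infinity sequentially"
      by (intro tendsto_add_filterlim_at_infinity[OF tendsto_const] tendsto_of_nat)
    have "filterlim (\<lambda>n. - z + of_nat n) at_infinity sequentially"
      by (intro tendsto_add_filterlim_at_infinity[OF tendsto_const] tendsto_of_nat)
    then have 2: "(\<lambda>n. - (1 / (- z + of_nat n))) \<longlonglongrightarrow> - 0"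
      by (intro tendsto_minus tendsto_divide_0[OF tendsto_const])
    have eq: "- (1 / (- z + of_nat n)) = 1 / (z - of_nat n)" for n
      by (metis add.commute minus_diff_eq minus_divide_right uminus_add_conv_diff)
    have "(\<lambda>n. - (1 / (- z + of_nat n)) - 1 / (z + of_nat n)) \<longlonglongrightarrow> - 0 - 0"
      by (intro tendsto_diff 2 tendsto_divide_0[OF tendsto_const 1])
    then show ?thesis by (simp only: eq minus_zero diff_zero)
  qed
  ultimately have "infsum ?f UNIV = 0"
    using LIMSEQ_unique by simp
  then show ?thesis
    using has_sum_infsum[OF summable] by simp
qed

text \<open>The decay that makes the sum over all rows converge. For \<open>k \<ge> 3\<close> it holds for the sum of the absolute values. For \<open>k = 2\<close> the
  absolute values only give \<open>O(1 / h)\<close>; subtracting the telescoping series, whose sum is \<open>0\<close>, turns the terms into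
  \<open>1 / ((z + b)\<^sup>2 * (z + b + 1))\<close> and wins a further factor \<open>1 / h\<close>. The factor \<open>(1 + 1 / h) ^ k\<close> only serves to
  state both cases at once, and it is bounded for \<open>h\<close> away from \<open>0\<close>.\<close>
lemma row_sum_bound:
  fixes z :: complex
  assumes z: "Im z \<noteq> 0" and k: "k \<ge> 2"
  defines "h \<equiv> \<bar>Im z\<bar>"
  shows "norm (\<Sum>\<^sub>\<infinity>b::int. 1 / (z + of_int b) ^ k) \<le> 4 * (1 + 1 / h) * (1 + 1 / h) ^ k / h ^ 2"
proof -
  have h: "h > 0" using z by (simp add: h_def)
  let ?B = "4 * (1 + 1 / h) / h"
  have main: "norm (\<Sum>\<^sub>\<infinity>b::int. 1 / (z + of_int b) ^ k) \<le> (1 / h) * (1 + 1 / h) ^ k * ?B"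
  proof (cases "k = 2")
    case True
    let ?g = "\<lambda>b::int. 1 / (z + of_int b) ^ 2"
    let ?f = "\<lambda>b::int. 1 / ((z + of_int b) * (z + of_int (b + 1)))"
    have s: "?g summable_on UNIV"
      by (rule abs_summable_summable[OF row_abs_summable(1)[OF z order_refl]])
    have "((\<lambda>b. ?g b - ?f b) has_sum (infsum ?g UNIV - 0)) UNIV"
      using has_sum_add[OF has_sum_infsum[OF s] has_sum_uminusI[OF row_telescope[OF z]]] by simp
    then have eq: "infsum ?g UNIV = (\<Sum>\<^sub>\<infinity>b. ?g b - ?f b)"
      by (simp add: infsumI)
    have le: "norm (?g b - ?f b) \<le> (1 / h) * (1 / norm (z + of_int b) ^ 2)" for b
    proof -
      have nz: "z + of_int b \<noteq> 0" for b
        using z by (auto simp: complex_eq_iff)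
      have "?g b - ?f b = (1 / (z + of_int (b + 1))) * (1 / (z + of_int b) ^ 2)"
        using nz[of b] nz[of "b + 1"] by (simp add: divide_simps power2_eq_square)
      moreover have "1 / norm (z + of_int (b + 1)) \<le> 1 / h"
        using abs_Im_le_cmod[of "z + of_int (b + 1)"] h nz[of "b + 1"]
        by (intro divide_left_mono) (auto simp: h_def)
      ultimately show ?thesis
        by (simp only: norm_mult norm_divide norm_power norm_one) (rule mult_right_mono, auto)
    qed
    have gs: "(\<lambda>b::int. (1 / h) * (1 / norm (z + of_int b) ^ 2)) summable_on UNIV"
      by (rule summable_on_cmult_right[OF row_sum_inverse_square(1)[OF z]])
    have "norm (infsum ?g UNIV) \<le> (\<Sum>\<^sub>\<infinity>b. norm (?g b - ?f b))"
      unfolding eq by (rule norm_infsum_bound[OF abs_summable_on_comparison_test'[OF gs le]])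
    also have "\<dots> \<le> (\<Sum>\<^sub>\<infinity>b::int. (1 / h) * (1 / norm (z + of_int b) ^ 2))"
      by (rule infsum_mono[OF abs_summable_on_comparison_test'[OF gs le] gs le])
    also have "\<dots> = (1 / h) * (\<Sum>\<^sub>\<infinity>b::int. 1 / norm (z + of_int b) ^ 2)"
      by (rule infsum_cmult_right) (use row_sum_inverse_square(1)[OF z] in auto)
    also have "\<dots> \<le> (1 / h) * ?B"
      using row_sum_inverse_square(2)[OF z] h by (intro mult_left_mono) (auto simp: h_def)
    also have "\<dots> \<le> (1 / h) * (1 + 1 / h) ^ k * ?B"
    proof (intro mult_right_mono)
      show "1 / h \<le> (1 / h) * (1 + 1 / h) ^ k"
        using mult_left_mono[OF one_le_power[of "1 + 1 / h" k], of "1 / h"] h by simp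
    qed (use h in auto)
    finally show ?thesis using True by simp
  next
    case False
    then obtain j where j: "k - 2 = Suc j" using k by (metis Suc_pred diff_is_0_eq le_antisym neq0_conv)
    have "norm (\<Sum>\<^sub>\<infinity>b::int. 1 / (z + of_int b) ^ k) \<le> 1 / h ^ (k - 2) * ?B"
      using norm_infsum_bound[OF row_abs_summable(1)[OF z k]] row_abs_summable(2)[OF z k]
      by (simp add: h_def)
    moreover have "1 / h ^ (k - 2) \<le> (1 / h) * (1 + 1 / h) ^ k"
    proof -
      have "(1 / h) ^ j \<le> (1 + 1 / h) ^ j"
        using h by (intro power_mono) auto
      also have "\<dots> \<le> (1 + 1 / h) ^ k"
        using h j by (intro power_increasing) auto
      finally have "(1 / h) * (1 / h) ^ j \<le> (1 / h) * (1 + 1 / h) ^ k"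
        using h by (intro mult_left_mono) auto
      then show ?thesis by (simp add: j power_one_over)
    qed
    moreover have "?B \<ge> 0" using h by simp
    ultimately show ?thesis
      using mult_right_mono order_trans by blast
  qed
  also have "(1 / h) * (1 + 1 / h) ^ k * ?B = 4 * (1 + 1 / h) * (1 + 1 / h) ^ k / h ^ 2"
    by (simp add: power2_eq_square)
  finally show ?thesis .
qed

section \<open>Chains of positive lattice points\<close>

text \<open>Lattice points are represented by their coordinates, so that \<open>(a, b)\<close> stands for \<open>a * \<tau> + b\<close> and \<open>a\<close> is its
  row. This is the order of the lattice, which is invariant under translations and reversed by reflections.\<close>
definition lex_less :: "int \<times> int \<Rightarrow> int \<times> int \<Rightarrow> bool" where
  "lex_less p q \<longleftrightarrow> fst p < fst q \<or> fst p = fst q \<and> snd p < snd q"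

lemma lex_less_irrefl [simp]: "\<not> lex_less p p"
  by (simp add: lex_less_def)

lemma lex_less_trans: "lex_less p q \<Longrightarrow> lex_less q r \<Longrightarrow> lex_less p r"
  by (auto simp: lex_less_def)

lemma lex_less_linear: "p = q \<or> lex_less p q \<or> lex_less q p"
  by (auto simp: lex_less_def prod_eq_iff)

lemma lex_less_diff_left [simp]: "lex_less (w - p) (w - q) \<longleftrightarrow> lex_less q p"
  by (auto simp: lex_less_def)

lemma lex_less_add_left [simp]: "lex_less (w + p) (w + q) \<longleftrightarrow> lex_less p q"
  by (auto simp: lex_less_def)

lemma lex_less_diff_right [simp]: "lex_less (p - w) (q - w) \<longleftrightarrow> lex_less p q"
  by (auto simp: lex_less_def)

text \<open>Positivity confines these chains to the rows from \<open>0\<close> to \<open>K - 1\<close>, and the columns are unbounded: this is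
  the index set of the inner limit in the definition of a multiple Eisenstein series.\<close>
definition pos_chains :: "nat \<Rightarrow> nat \<Rightarrow> (int \<times> int) list set" where
  "pos_chains s K =
     {ps. length ps = s \<and> sorted_wrt lex_less ps \<and> (\<forall>p\<in>set ps. lex_less 0 p \<and> fst p < int K)}"

definition row_chains :: "nat \<Rightarrow> int list set" where
  "row_chains s = {ns. length ns = s \<and> sorted_wrt (<) ns}"

locale upper_half_point =
  fixes \<tau> :: complex
  assumes Im_pos: "Im \<tau> > 0"
begin

definition point :: "int \<times> int \<Rightarrow> complex" where
  "point p = of_int (fst p) * \<tau> + of_int (snd p)"

lemma point_0 [simp]: "point 0 = 0"
  by (simp add: point_def)

lemma point_minus: "point (- p) = - point p"
  by (simp add: point_def algebra_simps)

lemma point_diff: "point (p - q) = point p - point q"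
  by (simp add: point_def algebra_simps)

lemma point_eq_0_iff [simp]: "point p = 0 \<longleftrightarrow> p = 0"
proof
  assume *: "point p = 0"
  then have "Im (point p) = 0" by simp
  then have "fst p = 0" using Im_pos by (simp add: point_def)
  with * show "p = 0" by (simp add: point_def prod_eq_iff)
qed simp

lemma point_eq_iff [simp]: "point p = point q \<longleftrightarrow> p = q"
  using point_eq_0_iff[of "p - q"] by (simp add: point_diff del: point_eq_0_iff)

lemma inj_point: "inj point"
  by (rule injI) simp

definition weight :: "nat list \<Rightarrow> (int \<times> int) list \<Rightarrow> complex" where
  "weight ks ps = (\<Prod>(k, p)\<leftarrow>zip ks ps. 1 / point p ^ k)"

lemma weight_append:
  "length ks = length ps \<Longrightarrow> weight (ks @ ls) (ps @ qs) = weight ks ps * weight ls qs"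
  by (simp add: weight_def)

lemma weight_rev: "length ks = length ps \<Longrightarrow> weight (rev ks) (rev ps) = weight ks ps"
proof (induction ks ps rule: list_induct2)
  case (Cons k ks p ps)
  then show ?case by (simp add: weight_append) (simp add: weight_def)
qed simp

lemma weight_uminus: "length ks = length ps \<Longrightarrow> weight ks (map uminus ps) = (-1) ^ sum_list ks * weight ks ps"
proof (induction ks ps rule: list_induct2)
  case (Cons k ks p ps)
  have "1 / point (- p) ^ k = (-1) ^ k * (1 / point p ^ k)"
    by (cases "even k") (simp_all add: point_minus)
  then show ?case using Cons by (simp add: weight_def power_add mult_ac)
qed (simp add: weight_def)

lemma norm_weight: "norm (weight ks ps) = (\<Prod>(k, p)\<leftarrow>zip ks ps. norm (1 / point p ^ k))"
  unfolding weight_def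
  by (induction ks ps rule: list_induct2') (simp_all add: norm_mult norm_divide)

lemma weight_eq_prod:
  "length ks = length ps \<Longrightarrow> weight ks ps = (\<Prod>j<length ks. 1 / point (ps ! j) ^ (ks ! j))"
  by (simp add: weight_def prod.list_conv_set_nth atLeast0LessThan)

lemma row_power_abs_summable:
  assumes "k \<ge> 2"
  shows "(\<lambda>b. norm (1 / point (a, b) ^ k)) summable_on UNIV"
proof (cases "a = 0")
  case False
  then show ?thesis
    using row_abs_summable(1)[of "of_int a * \<tau>" k] Im_pos assms by (simp add: point_def)
next
  case True
  \<comment> \<open>Row \<open>0\<close> contains the origin, where the term is \<open>1 / 0 = 0\<close>; elsewhere \<open>1 + b\<^sup>2 \<le> 2 * b\<^sup>2\<close>.\<close>
  have "(\<lambda>b. 2 * (1 / norm (\<i> + of_int b) ^ 2)) summable_on (UNIV :: int set)"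
    by (intro summable_on_cmult_right row_sum_inverse_square) auto
  then show ?thesis
  proof (rule summable_on_comparison_test)
    fix b :: int
    show "norm (1 / point (a, b) ^ k) \<le> 2 * (1 / norm (\<i> + of_int b) ^ 2)"
    proof (cases "b = 0")
      case False
      then have b: "1 \<le> \<bar>real_of_int b\<bar>" by linarith
      then have "1 + real_of_int b ^ 2 \<le> 2 * \<bar>real_of_int b\<bar> ^ 2"
        using one_le_power[OF b, of 2] by simp
      also have "\<dots> \<le> 2 * \<bar>real_of_int b\<bar> ^ k"
        by (intro mult_left_mono power_increasing assms b) auto
      finally have "1 + real_of_int b ^ 2 \<le> 2 * \<bar>real_of_int b\<bar> ^ k" .
      moreover have "1 + real_of_int b ^ 2 > 0"
        by (rule add_pos_nonneg) auto
      ultimately show ?thesis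
        using b by (simp add: True point_def norm_divide norm_power cmod_power2 divide_simps)
    qed (use assms in \<open>simp add: True point_def power_0_left\<close>)
  qed auto
qed

lemma rows_power_abs_summable:
  assumes "k \<ge> 2" "finite R"
  shows "(\<lambda>p. norm (1 / point p ^ k)) summable_on (R \<times> UNIV)"
proof -
  have "(\<lambda>p. norm (1 / point p ^ k)) summable_on ({a} \<times> UNIV)" for a
    by (subst summable_on_reindex_bij_betw[symmetric, where g = "Pair a" and A = UNIV])
       (use row_power_abs_summable[OF assms(1)] in \<open>auto intro!: bij_betwI[where g = snd]\<close>)
  then have "(\<lambda>p. norm (1 / point p ^ k)) summable_on (\<Union>a\<in>R. {a} \<times> UNIV)"
    by (intro summable_on_finite_union_disjoint assms) auto
  also have "(\<Union>a\<in>R. {a} \<times> UNIV) = R \<times> UNIV" by auto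
  finally show ?thesis .
qed

text \<open>Within finitely many rows everything converges absolutely. This allows all rearrangements
  below.\<close>
lemma weight_abs_summable:
  assumes "\<forall>k\<in>set ks. k \<ge> 2" "finite R"
    and "\<And>ps. ps \<in> L \<Longrightarrow> length ps = length ks \<and> fst ` set ps \<subseteq> R"
  shows "(\<lambda>ps. norm (weight ks ps)) summable_on L"
proof -
  have "((\<lambda>ps. \<Prod>(k, p)\<leftarrow>zip ks ps. norm (1 / point p ^ k)) has_sum
          (\<Prod>k\<leftarrow>ks. \<Sum>\<^sub>\<infinity>p\<in>R \<times> UNIV. norm (1 / point p ^ k)))
        {ps. length ps = length ks \<and> set ps \<subseteq> R \<times> UNIV}"
    by (intro has_sum_prod_list_zip has_sum_infsum rows_power_abs_summable assms) (use assms in auto)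
  then have "(\<lambda>ps. norm (weight ks ps)) summable_on {ps. length ps = length ks \<and> set ps \<subseteq> R \<times> UNIV}"
    unfolding norm_weight by (rule has_sum_imp_summable)
  then show ?thesis
    by (rule summable_on_subset) (use assms(3) in force)
qed

definition pos_sum :: "nat list \<Rightarrow> nat \<Rightarrow> complex" where
  "pos_sum ks K = infsum (weight ks) (pos_chains (length ks) K)"

lemma pos_chains_abs_summable:
  assumes "\<forall>k\<in>set ks. k \<ge> 2"
  shows "(\<lambda>ps. norm (weight ks ps)) summable_on pos_chains (length ks) K"
  by (rule weight_abs_summable[of _ "{0..int K}"]) (use assms in \<open>auto simp: pos_chains_def lex_less_def\<close>)

lemma pos_sum_has_sum:
  assumes "\<forall>k\<in>set ks. k \<ge> 2"
  shows "(weight ks has_sum pos_sum ks K) (pos_chains (length ks) K)"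
  unfolding pos_sum_def
  by (rule has_sum_infsum[OF abs_summable_summable[OF pos_chains_abs_summable[OF assms]]])

definition row_sum :: "int \<Rightarrow> nat list \<Rightarrow> complex" where
  "row_sum a ks = (\<Sum>\<^sub>\<infinity>ns\<in>row_chains (length ks). weight ks (map (Pair a) ns))"

lemma row_chains_abs_summable:
  assumes "\<forall>k\<in>set ks. k \<ge> 2"
  shows "(\<lambda>ns. norm (weight ks (map (Pair a) ns))) summable_on row_chains (length ks)"
proof -
  have "(\<lambda>ps. norm (weight ks ps)) summable_on (map (Pair a) ` row_chains (length ks))"
    by (rule weight_abs_summable[of _ "{a}"]) (use assms in \<open>auto simp: row_chains_def\<close>)
  then show ?thesis
    by (subst (asm) summable_on_reindex) (auto simp: o_def inj_on_def intro: map_injective)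
qed

text \<open>Points of the row \<open>K \<ge> 1\<close> are positive and come last in a chain, so a chain below row \<open>K + 1\<close> is a chain
  below row \<open>K\<close> followed by a chain in the row \<open>K\<close>.\<close>
lemma pos_sum_Suc:
  assumes ks: "\<forall>k\<in>set ks. k \<ge> 2" and K: "K \<ge> 1"
  shows "pos_sum ks (Suc K)
           = (\<Sum>i\<le>length ks. pos_sum (take i ks) K * row_sum (int K) (drop i ks))"
proof -
  let ?s = "length ks"
  \<comment> \<open>The chains whose members below row \<open>K\<close> are exactly the first \<open>i\<close>.\<close>
  define E where "E = (\<lambda>i. {ps \<in> pos_chains ?s (Suc K).
     (\<forall>p\<in>set (take i ps). fst p < int K) \<and> (\<forall>p\<in>set (drop i ps). fst p = int K)})"
  have "(weight ks has_sum (\<Sum>i\<le>?s. pos_sum (take i ks) K * row_sum (int K) (drop i ks)))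
          (\<Union>i\<le>?s. E i)"
  proof (rule sum_has_sum)
    fix i assume "i \<in> {..?s}"
    then have i: "i \<le> ?s" by simp
    have ks1: "\<forall>k\<in>set (take i ks). k \<ge> 2" and ks2: "\<forall>k\<in>set (drop i ks). k \<ge> 2"
      using ks by (auto dest: in_set_takeD in_set_dropD)
    have "((\<lambda>(l, ns). weight (take i ks) l * weight (drop i ks) (map (Pair (int K)) ns)) has_sum
            (pos_sum (take i ks) K * row_sum (int K) (drop i ks)))
          (pos_chains (length (take i ks)) K \<times> row_chains (length (drop i ks)))"
      unfolding row_sum_def
      by (intro has_sum_times pos_chains_abs_summable row_chains_abs_summable ks1 ks2 pos_sum_has_sum
            has_sum_infsum abs_summable_summable[OF row_chains_abs_summable])
    also have "?this \<longleftrightarrow>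
        (weight ks has_sum (pos_sum (take i ks) K * row_sum (int K) (drop i ks))) (E i)"
    proof (rule has_sum_reindex_bij_witness[where
          j = "\<lambda>(l, ns). l @ map (Pair (int K)) ns" and i = "\<lambda>ps. (take i ps, map snd (drop i ps))"])
      fix x assume "x \<in> pos_chains (length (take i ks)) K \<times> row_chains (length (drop i ks))"
      then obtain l ns where x: "x = (l, ns)" and l: "l \<in> pos_chains i K"
        and ns: "ns \<in> row_chains (?s - i)"
        using i by auto
      have len: "length l = i" "length ns = ?s - i"
        using l ns by (auto simp: pos_chains_def row_chains_def)
      show "(take i (case x of (l, ns) \<Rightarrow> l @ map (Pair (int K)) ns),
             map snd (drop i (case x of (l, ns) \<Rightarrow> l @ map (Pair (int K)) ns))) = x"
        by (simp add: x len o_def)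
      show "(case x of (l, ns) \<Rightarrow> l @ map (Pair (int K)) ns) \<in> E i"
        using l ns i K
        by (fastforce simp: x len E_def pos_chains_def row_chains_def sorted_wrt_append sorted_wrt_map lex_less_def)
      show "weight ks (case x of (l, ns) \<Rightarrow> l @ map (Pair (int K)) ns) =
            (case x of (l, ns) \<Rightarrow> weight (take i ks) l * weight (drop i ks) (map (Pair (int K)) ns))"
        using weight_append[of "take i ks" l "drop i ks" "map (Pair (int K)) ns"] len i
        by (simp add: x)
    next
      fix ps assume ps: "ps \<in> E i"
      have K_drop: "\<forall>p\<in>set (drop i ps). fst p = int K" and len: "length ps = ?s"
        and sorted: "sorted_wrt lex_less (take i ps @ drop i ps)"
        using ps by (auto simp: E_def pos_chains_def)
      have "map (\<lambda>p. (int K, snd p)) (drop i ps) = drop i ps"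
        using K_drop by (intro map_idI) (auto simp: prod_eq_iff)
      then show "(case (take i ps, map snd (drop i ps)) of (l, ns) \<Rightarrow> l @ map (Pair (int K)) ns) = ps"
        by (simp add: o_def)
      have "sorted_wrt (<) (map snd (drop i ps))"
        unfolding sorted_wrt_map
        by (rule sorted_wrt_mono_rel[of "drop i ps" lex_less])
           (use sorted K_drop in \<open>auto simp: lex_less_def sorted_wrt_append\<close>)
      then show "(take i ps, map snd (drop i ps)) \<in>
          pos_chains (length (take i ks)) K \<times> row_chains (length (drop i ks))"
        using ps len i sorted
        by (auto simp: E_def pos_chains_def row_chains_def sorted_wrt_append dest: in_set_takeD)
    qed simp
    finally show "(weight ks has_sum (pos_sum (take i ks) K * row_sum (int K) (drop i ks))) (E i)" .
  next
    fix i j assume "i \<in> {..?s}" "j \<in> {..?s}" "i \<noteq> j"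
    have False if "ps \<in> E i" "ps \<in> E j" "i < j" "j \<le> ?s" for ps i j
    proof -
      have len: "length ps = ?s" using that by (simp add: E_def pos_chains_def)
      have "drop i ps = ps ! i # drop (Suc i) ps"
        using that len by (simp add: Cons_nth_drop_Suc)
      then have "ps ! i \<in> set (drop i ps)" by simp
      moreover have "ps ! i \<in> set (take j ps)"
        using that len nth_mem[of i "take j ps"] by simp
      ultimately show False using that by (force simp: E_def)
    qed
    then show "E i \<inter> E j = {}"
      using \<open>i \<in> {..?s}\<close> \<open>j \<in> {..?s}\<close> \<open>i \<noteq> j\<close> by (metis atMost_iff disjoint_iff nat_neq_iff)
  qed simp
  also have "(\<Union>i\<le>?s. E i) = pos_chains ?s (Suc K)"
  proof (intro equalityI subsetI)
    fix ps assume ps: "ps \<in> pos_chains ?s (Suc K)"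
    define i where "i = length (takeWhile (\<lambda>p. fst p < int K) ps)"
    have tk: "take i ps = takeWhile (\<lambda>p. fst p < int K) ps"
      and dr: "drop i ps = dropWhile (\<lambda>p. fst p < int K) ps"
      unfolding i_def by (rule takeWhile_eq_take[symmetric], rule dropWhile_eq_drop[symmetric])
    have "fst p \<ge> int K" if "p \<in> set (drop i ps)" for p
    proof (cases "drop i ps")
      case (Cons x xs)
      have "sorted_wrt lex_less (x # xs)"
        using ps unfolding Cons[symmetric] by (auto simp: pos_chains_def sorted_wrt_drop)
      moreover have "fst x \<ge> int K"
        using hd_dropWhile[of "\<lambda>p. fst p < int K" ps, folded dr, unfolded Cons] by simp
      ultimately show ?thesis
        using that by (auto simp: Cons lex_less_def)
    qed (use that in simp)
    then have "\<forall>p\<in>set (drop i ps). fst p = int K"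
      using ps by (force simp: pos_chains_def dest: in_set_dropD)
    then have "ps \<in> E i"
      using ps by (auto simp: E_def tk dest: set_takeWhileD)
    moreover have "i \<le> ?s"
      using ps length_takeWhile_le[of "\<lambda>p. fst p < int K" ps] by (simp add: i_def pos_chains_def)
    ultimately show "ps \<in> (\<Union>i\<le>?s. E i)" by blast
  qed (auto simp: E_def)
  finally show ?thesis
    unfolding pos_sum_def by (rule infsumI)
qed

lemma row_sum_Nil [simp]: "row_sum a [] = 1"
proof -
  have "row_chains 0 = {[]}" by (auto simp: row_chains_def)
  then show ?thesis by (simp add: row_sum_def weight_def)
qed

definition row_total :: "nat \<Rightarrow> int \<Rightarrow> complex" where
  "row_total k a = (\<Sum>\<^sub>\<infinity>b. 1 / point (a, b) ^ k)"

lemma row_sum_single: "row_sum a [k] = row_total k a"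
proof -
  have "row_sum a [k] = (\<Sum>\<^sub>\<infinity>b\<in>UNIV. weight [k] (map (Pair a) [b]))"
    unfolding row_sum_def
    by (rule infsum_reindex_bij_witness[where i = "\<lambda>b. [b]" and j = hd])
       (auto simp: row_chains_def length_Suc_conv)
  then show ?thesis by (simp add: row_total_def weight_def)
qed

lemma row_total_bound:
  assumes "k \<ge> 2"
  shows "\<exists>C. \<forall>a. a \<noteq> 0 \<longrightarrow> norm (row_total k a) \<le> C / of_int a ^ 2"
proof (intro exI allI impI)
  fix a :: int assume a: "a \<noteq> 0"
  define y where "y = Im \<tau>"
  define h where "h = \<bar>of_int a\<bar> * y"
  have y: "y > 0" using Im_pos by (simp add: y_def)
  have "1 \<le> \<bar>real_of_int a\<bar>" using a by linarith
  then have h: "y \<le> h" using y by (simp add: h_def)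
  then have le: "1 + 1 / h \<le> 1 + 1 / y" using y by (simp add: frac_le)
  have "norm (row_total k a) \<le> 4 * (1 + 1 / h) * (1 + 1 / h) ^ k / h ^ 2"
    using row_sum_bound[of "of_int a * \<tau>" k] assms a Im_pos
    by (simp add: row_total_def point_def h_def y_def abs_mult)
  also have "\<dots> \<le> 4 * (1 + 1 / y) * (1 + 1 / y) ^ k / h ^ 2"
    using le y h by (intro divide_right_mono mult_mono power_mono) auto
  also have "\<dots> = 4 * (1 + 1 / y) * (1 + 1 / y) ^ k / y ^ 2 / of_int a ^ 2"
    by (simp add: h_def power_mult_distrib mult_ac)
  finally show "norm (row_total k a) \<le> 4 * (1 + 1 / y) * (1 + 1 / y) ^ k / y ^ 2 / of_int a ^ 2" .
qed

text \<open>A single point in the row is the case of \<open>row_sum_bound\<close>. From two points on, the absolute values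
  suffice, as each point contributes a factor \<open>O(1 / K)\<close>.\<close>
lemma row_sum_decay:
  assumes ks: "\<forall>k\<in>set ks. k \<ge> 2" and ne: "ks \<noteq> []"
  shows "\<exists>C. \<forall>K\<ge>1. norm (row_sum (int K) ks) \<le> C / real K ^ 2"
proof (cases "length ks = 1")
  case True
  then obtain k where k: "ks = [k]" by (metis One_nat_def Suc_length_conv length_0_conv)
  then obtain C where "\<forall>a. a \<noteq> 0 \<longrightarrow> norm (row_total k a) \<le> C / of_int a ^ 2"
    using row_total_bound ks by auto
  then have "norm (row_sum (int K) ks) \<le> C / real K ^ 2" if "K \<ge> 1" for K
    using that by (auto simp: k row_sum_single dest: spec[of _ "int K"])
  then show ?thesis by blast
next
  case False
  define y where "y = Im \<tau>"
  have y: "y > 0" using Im_pos by (simp add: y_def)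
  define c where "c = (\<lambda>k. 1 / y ^ (k - 2) * (4 * (1 + 1 / y) / y))"
  have c0: "c k \<ge> 0" for k using y by (simp add: c_def)
  show ?thesis
  proof (intro exI allI impI)
    fix K :: nat assume K: "K \<ge> 1"
    define h where "h = real K * y"
    have h: "y \<le> h" using y K by (simp add: h_def)
    define G where "G = (\<lambda>k. \<Sum>\<^sub>\<infinity>b. norm (1 / point (int K, b) ^ k))"
    have G: "0 \<le> G k \<and> G k \<le> c k / real K" if "k \<ge> 2" for k
    proof
      have "G k \<le> 1 / h ^ (k - 2) * (4 * (1 + 1 / h) / h)"
        using row_abs_summable(2)[of "of_nat K * \<tau>" k] K y that
        by (simp add: G_def point_def h_def y_def abs_mult)
      also have "\<dots> \<le> 1 / y ^ (k - 2) * (4 * (1 + 1 / y) / h)"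
        using h y by (intro mult_mono divide_right_mono divide_left_mono power_mono) (auto simp: frac_le)
      also have "\<dots> = c k / real K" by (simp add: c_def h_def)
      finally show "G k \<le> c k / real K" .
    qed (auto simp: G_def intro: infsum_nonneg)
    have G_prod: "0 \<le> (\<Prod>k\<leftarrow>ks. G k) \<and> (\<Prod>k\<leftarrow>ks. G k) \<le> (\<Prod>k\<leftarrow>ks. c k) / real K ^ length ks"
      using ks
    proof (induction ks)
      case (Cons k ks)
      have "(\<Prod>k\<leftarrow>ks. c k) \<ge> 0" by (rule prod_list_nonneg) (use c0 in auto)
      moreover have "G k * (\<Prod>k\<leftarrow>ks. G k) \<le> c k / real K * ((\<Prod>k\<leftarrow>ks. c k) / real K ^ length ks)"
        using Cons G[of k] c0[of k] by (intro mult_mono) auto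
      ultimately show ?case using Cons G[of k] by (simp add: mult_ac)
    qed simp
    have sums: "((\<lambda>ns. \<Prod>(k, b)\<leftarrow>zip ks ns. norm (1 / point (int K, b) ^ k)) has_sum (\<Prod>k\<leftarrow>ks. G k))
        {ns. length ns = length ks \<and> set ns \<subseteq> UNIV}"
      unfolding G_def
      by (intro has_sum_prod_list_zip has_sum_infsum row_power_abs_summable) (use ks in auto)
    have norm_eq: "norm (weight ks (map (Pair (int K)) ns))
        = (\<Prod>(k, b)\<leftarrow>zip ks ns. norm (1 / point (int K, b) ^ k))" for ns
      unfolding norm_weight zip_map2 by (simp add: case_prod_unfold o_def)
    have "norm (row_sum (int K) ks)
        \<le> (\<Sum>\<^sub>\<infinity>ns\<in>row_chains (length ks). norm (weight ks (map (Pair (int K)) ns)))"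
      unfolding row_sum_def by (rule norm_infsum_bound[OF row_chains_abs_summable[OF ks]])
    also have "\<dots> \<le> (\<Prod>k\<leftarrow>ks. G k)"
      by (rule has_sum_mono2[OF has_sum_infsum[OF row_chains_abs_summable[OF ks]]
            sums[folded norm_eq]]) (auto simp: row_chains_def)
    also have "\<dots> \<le> (\<Prod>k\<leftarrow>ks. c k) / real K ^ length ks"
      using G_prod by simp
    also have "\<dots> \<le> (\<Prod>k\<leftarrow>ks. c k) / real K ^ 2"
    proof (intro divide_left_mono power_increasing)
      show "2 \<le> length ks" using ne False by (cases ks; cases "tl ks") auto
      show "0 \<le> (\<Prod>k\<leftarrow>ks. c k)" by (rule prod_list_nonneg) (use c0 in auto)
    qed (use K in auto)
    finally show "norm (row_sum (int K) ks) \<le> (\<Prod>k\<leftarrow>ks. c k) / real K ^ 2" .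
  qed
qed

text \<open>By \<open>pos_sum_Suc\<close> an increment is a sum of products of truncated series of smaller depth, which are
  bounded by induction, and of sums over a row, which are \<open>O(1 / K\<^sup>2)\<close>.\<close>
lemma pos_sum_convergent:
  assumes "\<forall>k\<in>set ks. k \<ge> 2"
  shows "convergent (pos_sum ks)"
  using assms
proof (induction ks rule: length_induct)
  case (1 ks)
  have "\<exists>D. \<forall>K\<ge>1. norm (pos_sum (take i ks) K * row_sum (int K) (drop i ks)) \<le> D / real K ^ 2"
    if i: "i < length ks" for i
  proof -
    have "length (take i ks) < length ks" "\<forall>k\<in>set (take i ks). k \<ge> 2"
      using 1(2) i by (auto dest: in_set_takeD)
    then have "convergent (pos_sum (take i ks))"
      by (rule 1(1)[THEN spec, THEN mp, THEN mp])
    then obtain B where B: "\<And>K. norm (pos_sum (take i ks) K) \<le> B"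
      using convergent_imp_Bseq Bseq_def by metis
    obtain C where C: "\<forall>K\<ge>1. norm (row_sum (int K) (drop i ks)) \<le> C / real K ^ 2"
      using row_sum_decay[of "drop i ks"] 1 i by (auto dest: in_set_dropD)
    have "norm (pos_sum (take i ks) K * row_sum (int K) (drop i ks)) \<le> B * C / real K ^ 2"
      if "K \<ge> 1" for K
    proof -
      have "B \<ge> 0" using B[of 0] norm_ge_zero order_trans by blast
      then show ?thesis
        using mult_mono[OF B[of K] C[rule_format, OF that]] by (simp add: norm_mult)
    qed
    then show ?thesis by blast
  qed
  then obtain D where D: "\<And>i K. i < length ks \<Longrightarrow> K \<ge> 1 \<Longrightarrow>
      norm (pos_sum (take i ks) K * row_sum (int K) (drop i ks)) \<le> D i / real K ^ 2"
    by metis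
  have "summable (\<lambda>K. pos_sum ks (Suc K) - pos_sum ks K)"
  proof (rule summable_comparison_test_ev)
    show "eventually (\<lambda>K. norm (pos_sum ks (Suc K) - pos_sum ks K)
            \<le> (\<Sum>i<length ks. D i) * inverse (real K ^ 2)) at_top"
      using eventually_ge_at_top[of 1]
    proof eventually_elim
      case (elim K)
      have "pos_sum ks (Suc K) - pos_sum ks K
          = (\<Sum>i<length ks. pos_sum (take i ks) K * row_sum (int K) (drop i ks))"
        using pos_sum_Suc[OF 1(2)[rule_format, THEN ballI] elim]
        by (simp add: lessThan_Suc_atMost[symmetric])
      also have "norm \<dots> \<le> (\<Sum>i<length ks. D i / real K ^ 2)"
        by (intro sum_norm_le D elim) auto
      finally show ?case by (simp add: sum_distrib_right divide_inverse)
    qed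
    show "summable (\<lambda>K. (\<Sum>i<length ks. D i) * inverse (real K ^ 2))"
      by (intro summable_mult inverse_power_summable) auto
  qed
  then have "convergent (\<lambda>n. (\<Sum>K<n. pos_sum ks (Suc K) - pos_sum ks K) + pos_sum ks 0)"
    by (intro convergent_add convergent_const) (simp add: summable_iff_convergent)
  then show ?case by (simp add: sum_lessThan_telescope)
qed

lemma point_Pair: "point (m, n) = of_int m * \<tau> + of_int n"
  by (simp add: point_def)

lemma lattice_prec_point: "lattice_prec \<tau> (point p) (point q) \<longleftrightarrow> lex_less p q"
  unfolding lattice_prec_def point_Pair[symmetric] point_eq_iff
  by (cases p; cases q) (auto simp: lex_less_def)

lemma lattice_box_eq: "lattice_box \<tau> M N = point ` (ZZ M \<times> ZZ N)"
proof (intro equalityI subsetI)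
  fix w assume "w \<in> lattice_box \<tau> M N"
  then obtain m n where "w = point (m, n)" "(m, n) \<in> ZZ M \<times> ZZ N"
    unfolding lattice_box_def point_Pair by blast
  then show "w \<in> point ` (ZZ M \<times> ZZ N)" by (rule image_eqI)
next
  fix w assume "w \<in> point ` (ZZ M \<times> ZZ N)"
  then obtain m n where "w = point (m, n)" "m \<in> ZZ M" "n \<in> ZZ N" by fast
  then show "w \<in> lattice_box \<tau> M N"
    unfolding lattice_box_def point_Pair by blast
qed

lemma finite_ZZ: "finite (ZZ N)"
  by (rule finite_subset[of _ "{- int N..int N}"]) (auto simp: ZZ_def)

lemma chains_eq:
  "chains \<tau> s M N = map point ` {ps \<in> pos_chains s M. \<forall>p\<in>set ps. snd p \<in> ZZ N}"
proof (intro equalityI subsetI)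
  fix ws assume ws: "ws \<in> chains \<tau> s M N"
  then have "set ws \<subseteq> point ` (ZZ M \<times> ZZ N)"
    by (auto simp: chains_def lattice_box_eq)
  then have "ws \<in> lists (point ` (ZZ M \<times> ZZ N))" by auto
  then obtain ps where ps: "ws = map point ps" "set ps \<subseteq> ZZ M \<times> ZZ N"
    unfolding lists_image by auto
  have "sorted_wrt (lattice_prec \<tau>) (map point (0 # ps))" "length ps = s"
    using ws by (auto simp: chains_def ps)
  then show "ws \<in> map point ` {ps \<in> pos_chains s M. \<forall>p\<in>set ps. snd p \<in> ZZ N}"
    using ps unfolding sorted_wrt_map lattice_prec_point
    by (intro image_eqI[of _ _ ps]) (force simp: pos_chains_def ZZ_def)+
next
  fix ws assume "ws \<in> map point ` {ps \<in> pos_chains s M. \<forall>p\<in>set ps. snd p \<in> ZZ N}"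
  then obtain ps where ps: "ws = map point ps" "ps \<in> pos_chains s M" "\<forall>p\<in>set ps. snd p \<in> ZZ N"
    by blast
  have "sorted_wrt (lattice_prec \<tau>) (map point (0 # ps))"
    unfolding sorted_wrt_map lattice_prec_point using ps by (simp add: pos_chains_def)
  moreover have "set ps \<subseteq> ZZ M \<times> ZZ N"
    using ps by (fastforce simp: pos_chains_def lex_less_def ZZ_def)
  ultimately show "ws \<in> chains \<tau> s M N"
    using ps by (auto simp: chains_def lattice_box_eq pos_chains_def)
qed

lemma multi_eisenstein_eq_lim_pos_sum:
  assumes ks: "\<forall>k\<in>set ks. k \<ge> 2"
  shows "multi_eisenstein \<tau> ks = lim (pos_sum ks)"
proof -
  let ?s = "length ks"
  have "(\<lambda>N. \<Sum>ws\<in>chains \<tau> ?s M N. 1 / (\<Prod>j<?s. (ws ! j) ^ (ks ! j))) \<longlonglongrightarrow> pos_sum ks M" for M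
  proof -
    let ?F = "\<lambda>N. {ps \<in> pos_chains ?s M. \<forall>p\<in>set ps. snd p \<in> ZZ N}"
    have inj: "inj_on (map point) A" for A
      by (intro inj_on_subset[OF inj_mapI[OF inj_point]]) auto
    have "(\<Sum>ws\<in>chains \<tau> ?s M N. 1 / (\<Prod>j<?s. (ws ! j) ^ (ks ! j))) = sum (weight ks) (?F N)" for N
      unfolding chains_eq sum.reindex[OF inj]
      by (intro sum.cong refl) (auto simp: pos_chains_def weight_eq_prod prod_dividef)
    moreover have "(\<lambda>N. sum (weight ks) (?F N)) \<longlonglongrightarrow> pos_sum ks M"
    proof (rule has_sum_imp_tendsto_exhaustion[OF pos_sum_has_sum[OF ks]])
      fix N
      have "?F N \<subseteq> {ps. set ps \<subseteq> ZZ M \<times> ZZ N \<and> length ps = ?s}"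
        by (fastforce simp: pos_chains_def lex_less_def ZZ_def)
      then show "finite (?F N)"
        by (rule finite_subset) (intro finite_lists_length_eq finite_cartesian_product finite_ZZ)
    next
      fix ps assume ps: "ps \<in> pos_chains ?s M"
      have "eventually (\<lambda>N. \<forall>p\<in>set ps. snd p \<in> ZZ N) at_top"
      proof (intro eventually_ball_finite ballI)
        fix p show "eventually (\<lambda>N. snd p \<in> ZZ N) at_top"
          using eventually_gt_at_top[of "nat \<bar>snd p\<bar>"] by eventually_elim (auto simp: ZZ_def)
      qed simp
      then show "eventually (\<lambda>N. ps \<in> ?F N) at_top"
        using ps by simp
    qed auto
    ultimately show ?thesis by simp
  qed
  then have "lim (\<lambda>N. \<Sum>ws\<in>chains \<tau> ?s M N. 1 / (\<Prod>j<?s. (ws ! j) ^ (ks ! j))) = pos_sum ks M" for M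
    by (rule limI)
  then show ?thesis
    by (simp add: multi_eisenstein_def)
qed

lemma pos_sum_tendsto:
  assumes "\<forall>k\<in>set ks. k \<ge> 2"
  shows "pos_sum ks \<longlonglongrightarrow> multi_eisenstein \<tau> ks"
  unfolding multi_eisenstein_eq_lim_pos_sum[OF assms]
  by (rule convergent_LIMSEQ_iff[THEN iffD1, OF pos_sum_convergent[OF assms]])

lemma row_total_has_sum:
  assumes "k \<ge> 2"
  shows "((\<lambda>p. 1 / point p ^ k) has_sum row_total k a) ({a} \<times> UNIV)"
proof -
  have "((\<lambda>b. 1 / point (a, b) ^ k) has_sum row_total k a) UNIV"
    unfolding row_total_def
    by (rule has_sum_infsum[OF abs_summable_summable[OF row_power_abs_summable[OF assms]]])
  also have "?this \<longleftrightarrow> ((\<lambda>p. 1 / point p ^ k) has_sum row_total k a) ({a} \<times> UNIV)"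
    by (rule has_sum_reindex_bij_betw) (auto intro!: bij_betwI[where g = snd])
  finally show ?thesis .
qed

text \<open>The squared distances of \<open>\<i>\<close> from the integers give the majorant \<open>1 / (1 + a\<^sup>2)\<close>.\<close>
lemma row_total_abs_summable:
  assumes "k \<ge> 2"
  shows "(\<lambda>a. norm (row_total k a)) summable_on UNIV"
proof -
  obtain C where C: "\<And>a. a \<noteq> 0 \<Longrightarrow> norm (row_total k a) \<le> C / of_int a ^ 2"
    using row_total_bound[OF assms] by blast
  define D where "D = max (norm (row_total k 0)) (2 * C)"
  have "(\<lambda>a. D * (1 / norm (\<i> + of_int a) ^ 2)) summable_on (UNIV :: int set)"
    by (intro summable_on_cmult_right row_sum_inverse_square) auto
  then show ?thesis
  proof (rule summable_on_comparison_test)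
    fix a :: int
    show "norm (row_total k a) \<le> D * (1 / norm (\<i> + of_int a) ^ 2)"
    proof (cases "a = 0")
      case False
      then have a: "1 \<le> real_of_int a ^ 2"
        using int_one_le_iff_zero_less by (metis of_int_1_le_iff of_int_power zero_less_power2)
      have "C / of_int a ^ 2 \<ge> 0" using C[OF False] norm_ge_zero order_trans by blast
      then have "C \<ge> 0" using a False by (simp add: zero_le_divide_iff)
      have "norm (row_total k a) \<le> C / of_int a ^ 2" by (rule C[OF False])
      also have "\<dots> \<le> 2 * C / (1 + of_int a ^ 2)"
        using False a mult_left_mono[OF a \<open>C \<ge> 0\<close>]
        by (simp add: divide_simps) (simp add: algebra_simps)
      also have "\<dots> \<le> D / (1 + of_int a ^ 2)"
        by (intro divide_right_mono) (auto simp: D_def)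
      finally show ?thesis by (simp add: cmod_power2 add_ac)
    qed (simp add: D_def)
  qed auto
qed

lemma eisenstein_eq_infsum_row_total:
  assumes k: "k \<ge> 2"
  shows "eisenstein \<tau> k = (\<Sum>\<^sub>\<infinity>a. row_total k a)"
proof -
  have "(\<lambda>N. \<Sum>(m, n)\<in>ZZ M \<times> ZZ N - {(0, 0)}. 1 / (of_int m * \<tau> + of_int n) ^ k)
          \<longlonglongrightarrow> (\<Sum>a\<in>ZZ M. row_total k a)" for M
  proof -
    have "((\<lambda>p. 1 / point p ^ k) has_sum (\<Sum>a\<in>ZZ M. row_total k a)) (\<Union>a\<in>ZZ M. {a} \<times> UNIV)"
      by (intro sum_has_sum row_total_has_sum k finite_ZZ) auto
    also have "?this \<longleftrightarrow> ((\<lambda>p. 1 / point p ^ k) has_sum (\<Sum>a\<in>ZZ M. row_total k a)) (ZZ M \<times> UNIV - {(0, 0)})"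
      by (rule has_sum_cong_neutral) (use k in \<open>auto simp: point_def\<close>)
    finally have "(\<lambda>N. \<Sum>p\<in>ZZ M \<times> ZZ N - {(0, 0)}. 1 / point p ^ k) \<longlonglongrightarrow> (\<Sum>a\<in>ZZ M. row_total k a)"
    proof (rule has_sum_imp_tendsto_exhaustion)
      fix p :: "int \<times> int" assume p: "p \<in> ZZ M \<times> UNIV - {(0, 0)}"
      show "eventually (\<lambda>N. p \<in> ZZ M \<times> ZZ N - {(0, 0)}) at_top"
        using eventually_gt_at_top[of "nat \<bar>snd p\<bar>"]
        by eventually_elim (use p in \<open>auto simp: ZZ_def\<close>)
    qed (auto simp: finite_ZZ)
    then show ?thesis by (simp add: point_def case_prod_unfold)
  qed
  then have "lim (\<lambda>N. \<Sum>(m, n)\<in>ZZ M \<times> ZZ N - {(0, 0)}. 1 / (of_int m * \<tau> + of_int n) ^ k)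
      = (\<Sum>a\<in>ZZ M. row_total k a)" for M
    by (rule limI)
  moreover have "(\<lambda>M. \<Sum>a | \<bar>a\<bar> < int M. row_total k a * 1) \<longlonglongrightarrow> (\<Sum>\<^sub>\<infinity>a. row_total k a) * 1"
    by (rule tannery_symmetric_int[where B = 1, OF row_total_abs_summable[OF k]]) auto
  then have "lim (\<lambda>M. \<Sum>a\<in>ZZ M. row_total k a) = (\<Sum>\<^sub>\<infinity>a. row_total k a)"
    by (intro limI) (simp add: ZZ_def)
  ultimately show ?thesis by (simp add: eisenstein_def)
qed

end

section \<open>Chains running through the whole strip\<close>

definition all_chains :: "nat \<Rightarrow> nat \<Rightarrow> (int \<times> int) list set" where
  "all_chains r M = {ps. length ps = r \<and> sorted_wrt lex_less ps \<and> (\<forall>p\<in>set ps. \<bar>fst p\<bar> < int M)}"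

text \<open>A chain is determined by its \<open>i\<close>-th member \<open>w\<close> and the differences to it, which are positive chains once
  those on the left are reflected. The strip bounds the rows of these differences in terms of the row of \<open>w\<close>.\<close>
lemma bij_betw_chains_around:
  assumes "i < r"
  shows "bij_betw (\<lambda>(w, l, q). rev (map ((-) w) l) @ w # map ((+) w) q)
           (SIGMA w:{a. \<bar>a\<bar> < int M} \<times> UNIV.
              pos_chains i (nat (int M + fst w)) \<times> pos_chains (r - Suc i) (nat (int M - fst w)))
           (all_chains r M)"
    (is "bij_betw ?f ?S _")
proof (rule bij_betwI[where
    g = "\<lambda>ps. (ps ! i, rev (map ((-) (ps ! i)) (take i ps)), map (\<lambda>p. p - ps ! i) (drop (Suc i) ps))"])
  show "?f \<in> ?S \<rightarrow> all_chains r M"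
  proof
    fix x assume "x \<in> ?S"
    then obtain w l q where x: "x = (w, l, q)" and w: "\<bar>fst w\<bar> < int M"
      and l: "l \<in> pos_chains i (nat (int M + fst w))"
      and q: "q \<in> pos_chains (r - Suc i) (nat (int M - fst w))"
      by auto
    have nat: "int (nat (int M + fst w)) = int M + fst w" "int (nat (int M - fst w)) = int M - fst w"
      using w by auto
    have l': "lex_less (w - p) w \<and> \<bar>fst w - fst p\<bar> < int M" if "p \<in> set l" for p
    proof -
      have "lex_less 0 p" "fst p < int M + fst w"
        using l that unfolding pos_chains_def nat by blast+
      then show ?thesis using w by (auto simp: lex_less_def)
    qed
    have q': "lex_less w (w + p) \<and> \<bar>fst w + fst p\<bar> < int M" if "p \<in> set q" for p
    proof -
      have "lex_less 0 p" "fst p < int M - fst w"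
        using q that unfolding pos_chains_def nat by blast+
      then show ?thesis using w by (auto simp: lex_less_def)
    qed
    have lq: "lex_less (w - p) (w + p')" if "p \<in> set l" "p' \<in> set q" for p p'
      using l'[OF that(1)] q'[OF that(2)] lex_less_trans by blast
    show "?f x \<in> all_chains r M"
      using l q w assms l' q' lq
      by (auto simp: x all_chains_def pos_chains_def sorted_wrt_append sorted_wrt_rev sorted_wrt_map)
  qed
  show "(\<lambda>ps. (ps ! i, rev (map ((-) (ps ! i)) (take i ps)), map (\<lambda>p. p - ps ! i) (drop (Suc i) ps)))
          \<in> all_chains r M \<rightarrow> ?S"
  proof
    fix ps assume ps: "ps \<in> all_chains r M"
    have split: "ps = take i ps @ ps ! i # drop (Suc i) ps"
      using ps assms by (intro id_take_nth_drop) (simp add: all_chains_def)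
    have sorted: "sorted_wrt lex_less (take i ps @ ps ! i # drop (Suc i) ps)"
      using ps split by (simp add: all_chains_def)
    have bound: "\<bar>fst p\<bar> < int M" if "p \<in> set ps" for p
      using ps that by (simp add: all_chains_def)
    have len: "length ps = r" using ps by (simp add: all_chains_def)
    have mem: "ps ! i \<in> set ps" using len assms by simp
    have "lex_less 0 (ps ! i - p) \<and> fst (ps ! i) - fst p < int M + fst (ps ! i)" if "p \<in> set (take i ps)" for p
      using sorted that bound[OF in_set_takeD[OF that]]
      by (auto simp: sorted_wrt_append lex_less_def)
    moreover have "lex_less 0 (p - ps ! i) \<and> fst p - fst (ps ! i) < int M - fst (ps ! i)"
      if "p \<in> set (drop (Suc i) ps)" for p
      using sorted that bound[OF in_set_dropD[OF that]]
      by (auto simp: sorted_wrt_append lex_less_def)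
    ultimately show "(ps ! i, rev (map ((-) (ps ! i)) (take i ps)), map (\<lambda>p. p - ps ! i) (drop (Suc i) ps)) \<in> ?S"
      using sorted len assms bound[OF mem]
      by (auto simp: pos_chains_def sorted_wrt_append sorted_wrt_rev sorted_wrt_map mem_Times_iff)
  qed
  fix x assume "x \<in> ?S"
  then obtain w l q where x: "x = (w, l, q)" and len: "length l = i"
    by (auto simp: pos_chains_def)
  have "?f x ! i = w" by (simp add: x len nth_append)
  then show "(?f x ! i, rev (map ((-) (?f x ! i)) (take i (?f x))),
              map (\<lambda>p. p - ?f x ! i) (drop (Suc i) (?f x))) = x"
    by (simp add: x len rev_map o_def)
next
  fix ps assume ps: "ps \<in> all_chains r M"
  then have "take i ps @ ps ! i # drop (Suc i) ps = ps"
    using assms by (intro id_take_nth_drop[symmetric]) (simp add: all_chains_def)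
  then show "?f (ps ! i, rev (map ((-) (ps ! i)) (take i ps)), map (\<lambda>p. p - ps ! i) (drop (Suc i) ps)) = ps"
    by (simp add: rev_map o_def)
qed

lemma filterlim_nat_int_shift: "filterlim (\<lambda>M. nat (int M + a)) at_top at_top"
  unfolding filterlim_at_top
proof
  fix Z
  show "eventually (\<lambda>M. Z \<le> nat (int M + a)) at_top"
    using eventually_ge_at_top[of "nat (int Z - a)"] by eventually_elim auto
qed

lemma prod_minus_index:
  fixes g :: "nat \<Rightarrow> 'a :: comm_monoid_mult"
  assumes "i < r"
  shows "(\<Prod>j\<in>{..<r} - {i}. g j) = (\<Prod>j<i. g j) * (\<Prod>j<r - Suc i. g (Suc i + j))"
proof -
  have eq: "{..<r} - {i} = {..<i} \<union> {Suc i..<r}" using assms by auto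
  have "(\<Prod>j\<in>{..<r} - {i}. g j) = (\<Prod>j<i. g j) * (\<Prod>j\<in>{Suc i..<r}. g j)"
    unfolding eq by (rule prod.union_disjoint) auto
  also have "(\<Prod>j\<in>{Suc i..<r}. g j) = (\<Prod>j<r - Suc i. g (Suc i + j))"
    using prod.atLeastLessThan_shift_0[of g "Suc i" r] by (simp add: atLeast0LessThan o_def)
  finally show ?thesis .
qed

text \<open>The convergence results above are for indices that are at least 2. The next three lemmas show that this is
  the case in every term whose coefficient does not vanish.\<close>
lemma binom1_neq_0_imp:
  assumes "binom1 n l \<noteq> 0" "l \<ge> 1"
  shows "n \<ge> 2"
  using assms by (cases "n - 1 < l") (auto simp: binom1_def)

lemma prod_binom1_neq_0_imp:
  assumes "(\<Prod>j\<in>J. binom1 (ns ! j) (ks ! j - 1)) \<noteq> 0" "finite J" "j \<in> J" "ks ! j \<ge> 2"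
  shows "ns ! j \<ge> 2"
  using assms by (intro binom1_neq_0_imp[of _ "ks ! j - 1"]) auto

lemma all_set_take_drop:
  assumes "length ns = r" "i < r" "\<And>j. j < r \<Longrightarrow> j \<noteq> i \<Longrightarrow> P (ns ! j)"
  shows "\<forall>n\<in>set (take i ns). P n" "\<forall>n\<in>set (drop (Suc i) ns). P n"
  using assms by (auto simp: in_set_conv_nth)

context upper_half_point
begin

text \<open>The summand that \<open>residue_identity\<close> attaches to the pole at the \<open>i\<close>-th member of a chain, with the factors to the left
  and to the right of this member separated.\<close>
definition centred_term :: "nat list \<Rightarrow> nat \<Rightarrow> (int \<times> int) list \<Rightarrow> complex" where
  "centred_term ns i ps =
     weight (take i ns) (map (\<lambda>p. p - ps ! i) (take i ps)) * (1 / point (ps ! i) ^ (ns ! i)) *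
     weight (drop (Suc i) ns) (map (\<lambda>p. p - ps ! i) (drop (Suc i) ps))"

text \<open>The summand of the second sum on the right of \<open>residue_identity\<close>.\<close>
definition zero_term :: "nat list \<Rightarrow> nat \<Rightarrow> (int \<times> int) list \<Rightarrow> complex" where
  "zero_term ns i ps =
     (if ps ! i = 0 then weight (take i ns) (take i ps) * weight (drop (Suc i) ns) (drop (Suc i) ps) else 0)"

lemma weight_reflect:
  assumes "length ks = length ps"
  shows "weight ks (rev (map uminus ps)) = (-1) ^ sum_list ks * weight (rev ks) ps"
  using weight_uminus[of ks "rev ps"] weight_rev[of "rev ks" ps] assms by (simp add: rev_map)

text \<open>Here the sum over the chains around a fixed \<open>w\<close> depends only on the row of \<open>w\<close>, so the sum over the points
  \<open>w\<close> of one row can be carried out separately.\<close>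
lemma centred_term_has_sum:
  assumes "i < r" and len: "length ns = r" and ns: "\<forall>n\<in>set ns. n \<ge> 2"
  shows "(centred_term ns i has_sum
           ((-1) ^ sum_list (take i ns) * (\<Sum>a | \<bar>a\<bar> < int M. row_total (ns ! i) a *
              (pos_sum (rev (take i ns)) (nat (int M + a)) * pos_sum (drop (Suc i) ns) (nat (int M - a))))))
         (all_chains r M)"
proof -
  let ?l = "rev (take i ns)" and ?q = "drop (Suc i) ns" and ?n = "ns ! i"
  let ?R = "{a. \<bar>a\<bar> < int M}"
  have l2: "\<forall>k\<in>set ?l. k \<ge> 2" and q2: "\<forall>k\<in>set ?q. k \<ge> 2" and n2: "?n \<ge> 2"
    using ns assms(1) len by (auto dest: in_set_takeD in_set_dropD)
  have len_l: "length ?l = i" and len_q: "length ?q = r - Suc i"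
    using assms(1) len by auto
  define S where "S = (\<lambda>a. ({a} \<times> (UNIV :: int set)) \<times> (pos_chains i (nat (int M + a)) \<times> pos_chains (r - Suc i) (nat (int M - a))))"
  define v where "v = (\<lambda>a. row_total ?n a * (pos_sum ?l (nat (int M + a)) * pos_sum ?q (nat (int M - a))))"
  let ?g = "\<lambda>(w, l, q). 1 / point w ^ ?n * (weight ?l l * weight ?q q)"
  have fin: "finite ?R"
    by (rule finite_subset[of _ "{- int M..int M}"]) auto
  have row: "(?g has_sum v a) (S a)" for a
  proof -
    let ?P = "pos_chains i (nat (int M + a))" and ?Q = "pos_chains (r - Suc i) (nat (int M - a))"
    note Ps = pos_chains_abs_summable[OF l2, of "nat (int M + a)", unfolded len_l]
      and Qs = pos_chains_abs_summable[OF q2, of "nat (int M - a)", unfolded len_q]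
    have PQ: "((\<lambda>(l, q). weight ?l l * weight ?q q) has_sum
                (pos_sum ?l (nat (int M + a)) * pos_sum ?q (nat (int M - a)))) (?P \<times> ?Q)"
      using has_sum_times[OF Ps Qs] pos_sum_has_sum[OF l2] pos_sum_has_sum[OF q2]
      unfolding len_l len_q by blast
    have "((\<lambda>(l, q). norm (weight ?l l) * norm (weight ?q q)) has_sum
            (infsum (\<lambda>l. norm (weight ?l l)) ?P * infsum (\<lambda>q. norm (weight ?q q)) ?Q)) (?P \<times> ?Q)"
      by (intro has_sum_times has_sum_infsum) (use Ps Qs in simp_all)
    then have PQs: "(\<lambda>x. norm (case x of (l, q) \<Rightarrow> weight ?l l * weight ?q q)) summable_on (?P \<times> ?Q)"
      by (auto dest!: has_sum_imp_summable simp: case_prod_unfold norm_mult)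
    have Rs: "(\<lambda>p. norm (1 / point p ^ ?n)) summable_on ({a} \<times> UNIV)"
      by (rule rows_power_abs_summable[OF n2]) simp
    from has_sum_times[OF Rs PQs row_total_has_sum[OF n2] PQ]
    show ?thesis unfolding S_def v_def by (simp add: case_prod_unfold)
  qed
  have "(?g has_sum (\<Sum>a\<in>?R. v a)) (\<Union>a\<in>?R. S a)"
    by (rule sum_has_sum[OF fin row]) (auto simp: S_def)
  also have "(\<Union>a\<in>?R. S a) = (SIGMA w:?R \<times> UNIV.
      pos_chains i (nat (int M + fst w)) \<times> pos_chains (r - Suc i) (nat (int M - fst w)))"
    (is "_ = ?S")
    by (auto simp: S_def)
  finally have "((\<lambda>x. (-1) ^ sum_list (take i ns) * ?g x) has_sum
      ((-1) ^ sum_list (take i ns) * (\<Sum>a\<in>?R. v a))) ?S"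
    by (rule has_sum_cmult_right)
  also have "?this \<longleftrightarrow> ((\<lambda>x. centred_term ns i (case x of (w, l, q) \<Rightarrow> rev (map ((-) w) l) @ w # map ((+) w) q))
      has_sum ((-1) ^ sum_list (take i ns) * (\<Sum>a\<in>?R. v a))) ?S"
  proof (rule has_sum_cong)
    fix x assume "x \<in> ?S"
    then obtain w l q where x: "x = (w, l, q)" and l: "length l = i"
      by (auto simp: pos_chains_def)
    define ps where "ps = rev (map ((-) w) l) @ w # map ((+) w) q"
    have "ps ! i = w" by (simp add: ps_def l nth_append)
    moreover have "map (\<lambda>p. p - w) (take i ps) = rev (map uminus l)"
      by (simp add: ps_def l rev_map o_def)
    moreover have "map (\<lambda>p. p - w) (drop (Suc i) ps) = q"
      by (simp add: ps_def l o_def)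
    moreover have "weight (take i ns) (rev (map uminus l)) = (-1) ^ sum_list (take i ns) * weight ?l l"
      by (rule weight_reflect) (use l assms(1) len in simp)
    ultimately show "(-1) ^ sum_list (take i ns) * ?g x =
        centred_term ns i (case x of (w, l, q) \<Rightarrow> rev (map ((-) w) l) @ w # map ((+) w) q)"
      by (simp add: x centred_term_def mult_ac flip: ps_def)
  qed
  also have "\<dots> \<longleftrightarrow> (centred_term ns i has_sum ((-1) ^ sum_list (take i ns) * (\<Sum>a\<in>?R. v a))) (all_chains r M)"
    by (rule has_sum_reindex_bij_betw[OF bij_betw_chains_around[OF assms(1)]])
  finally show ?thesis unfolding v_def .
qed

lemma zero_term_has_sum:
  assumes "i < r" "M \<ge> 1" and len: "length ns = r"
    and l2: "\<forall>n\<in>set (take i ns). n \<ge> 2" and q2: "\<forall>n\<in>set (drop (Suc i) ns). n \<ge> 2"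
  shows "(zero_term ns i has_sum
           ((-1) ^ sum_list (take i ns) * (pos_sum (rev (take i ns)) M * pos_sum (drop (Suc i) ns) M)))
         (all_chains r M)"
proof -
  let ?l = "rev (take i ns)" and ?q = "drop (Suc i) ns"
  have l2': "\<forall>k\<in>set ?l. k \<ge> 2" using l2 by simp
  have len_l: "length ?l = i" and len_q: "length ?q = r - Suc i"
    using assms(1) len by auto
  let ?P = "pos_chains i M" and ?Q = "pos_chains (r - Suc i) M"
  let ?v = "(-1) ^ sum_list (take i ns) * (pos_sum ?l M * pos_sum ?q M)"
  let ?S = "SIGMA w:{a. \<bar>a\<bar> < int M} \<times> (UNIV :: int set).
      pos_chains i (nat (int M + fst w)) \<times> pos_chains (r - Suc i) (nat (int M - fst w))"
  let ?f = "\<lambda>(w, l, q). rev (map ((-) w) l) @ w # map ((+) w) q"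
  have "((\<lambda>(l, q). weight ?l l * weight ?q q) has_sum (pos_sum ?l M * pos_sum ?q M)) (?P \<times> ?Q)"
    using has_sum_times[OF pos_chains_abs_summable[OF l2'] pos_chains_abs_summable[OF q2]
        pos_sum_has_sum[OF l2'] pos_sum_has_sum[OF q2], of M M]
    unfolding len_l len_q .
  then have "((\<lambda>y. (-1) ^ sum_list (take i ns) * (case y of (l, q) \<Rightarrow> weight ?l l * weight ?q q)) has_sum ?v) (?P \<times> ?Q)"
    by (rule has_sum_cmult_right)
  also have "?this \<longleftrightarrow> ((\<lambda>x. zero_term ns i (?f x)) has_sum ?v) (Pair 0 ` (?P \<times> ?Q))"
  proof (subst has_sum_reindex, simp add: inj_on_def, rule has_sum_cong)
    fix y assume "y \<in> ?P \<times> ?Q"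
    then obtain l q where y: "y = (l, q)" and l: "length l = i"
      by (auto simp: pos_chains_def)
    define ps where "ps = rev (map ((-) 0) l) @ 0 # map ((+) 0) q"
    have "ps ! i = 0" by (simp add: ps_def l nth_append)
    moreover have "take i ps = rev (map uminus l)" "drop (Suc i) ps = q"
      by (simp_all add: ps_def l map_idI)
    moreover have "weight (take i ns) (rev (map uminus l)) = (-1) ^ sum_list (take i ns) * weight ?l l"
      by (rule weight_reflect) (use l assms(1) len in simp)
    ultimately have "zero_term ns i ps = (-1) ^ sum_list (take i ns) * (weight ?l l * weight ?q q)"
      by (simp add: zero_term_def)
    then show "(-1) ^ sum_list (take i ns) * (case y of (l, q) \<Rightarrow> weight ?l l * weight ?q q) =
        ((\<lambda>x. zero_term ns i (?f x)) \<circ> Pair 0) y"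
      by (simp add: y ps_def)
  qed
  also have "\<dots> \<longleftrightarrow> ((\<lambda>x. zero_term ns i (?f x)) has_sum ?v) ?S"
  proof (rule has_sum_cong_neutral)
    fix x assume x: "x \<in> ?S - Pair 0 ` (?P \<times> ?Q)"
    then obtain w l q where x': "x = (w, l, q)" and l: "length l = i"
      by (auto simp: pos_chains_def)
    have "w \<noteq> 0" using x by (auto simp: x')
    moreover have "?f x ! i = w" by (simp add: x' l nth_append)
    ultimately show "zero_term ns i (?f x) = 0"
      by (simp add: zero_term_def)
  qed (use assms(2) in \<open>auto simp: mem_Times_iff zero_prod_def\<close>)
  also have "\<dots> \<longleftrightarrow> (zero_term ns i has_sum ?v) (all_chains r M)"
    by (rule has_sum_reindex_bij_betw[OF bij_betw_chains_around[OF assms(1)]])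
  finally show ?thesis .
qed

text \<open>The weight of a chain through \<open>0\<close> is \<open>0\<close>, and any other chain consists of \<open>i\<close> negative points, whose
  negatives in the opposite order form a positive chain, followed by a positive chain.\<close>
lemma weight_has_sum_all_chains:
  assumes len: "length ns = r" and ns: "\<forall>n\<in>set ns. n \<ge> 2"
  shows "(weight ns has_sum
           (\<Sum>i\<le>r. (-1) ^ sum_list (take i ns) * (pos_sum (rev (take i ns)) M * pos_sum (drop i ns) M)))
         (all_chains r M)"
proof -
  define v where "v = (\<lambda>i. (-1) ^ sum_list (take i ns) * (pos_sum (rev (take i ns)) M * pos_sum (drop i ns) M))"
  \<comment> \<open>The chains that avoid \<open>0\<close> and whose negative members are exactly the first \<open>i\<close>.\<close>
  define E where "E = (\<lambda>i. {ps \<in> all_chains r M.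
     (\<forall>p\<in>set (take i ps). lex_less p 0) \<and> (\<forall>p\<in>set (drop i ps). lex_less 0 p)})"
  have "(weight ns has_sum (\<Sum>i\<le>r. v i)) (\<Union>i\<le>r. E i)"
  proof (rule sum_has_sum)
    fix i assume "i \<in> {..r}"
    then have i: "i \<le> r" by simp
    let ?l = "rev (take i ns)" and ?q = "drop i ns"
    have l2: "\<forall>k\<in>set ?l. k \<ge> 2" and q2: "\<forall>k\<in>set ?q. k \<ge> 2"
      using ns by (auto dest: in_set_takeD in_set_dropD)
    have len_l: "length ?l = i" and len_q: "length ?q = r - i"
      using i len by auto
    let ?P = "pos_chains i M" and ?Q = "pos_chains (r - i) M"
    have "((\<lambda>(l, q). weight ?l l * weight ?q q) has_sum (pos_sum ?l M * pos_sum ?q M)) (?P \<times> ?Q)"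
      using has_sum_times[OF pos_chains_abs_summable[OF l2] pos_chains_abs_summable[OF q2]
          pos_sum_has_sum[OF l2] pos_sum_has_sum[OF q2], of M M]
      unfolding len_l len_q .
    then have "((\<lambda>y. (-1) ^ sum_list (take i ns) * (case y of (l, q) \<Rightarrow> weight ?l l * weight ?q q)) has_sum v i) (?P \<times> ?Q)"
      unfolding v_def by (rule has_sum_cmult_right)
    also have "?this \<longleftrightarrow> (weight ns has_sum v i) (E i)"
    proof (rule has_sum_reindex_bij_witness[where
          j = "\<lambda>(l, q). rev (map uminus l) @ q" and i = "\<lambda>ps. (rev (map uminus (take i ps)), drop i ps)"])
      fix x assume "x \<in> ?P \<times> ?Q"
      then obtain l q where x: "x = (l, q)" and l: "l \<in> ?P" and q: "q \<in> ?Q" by auto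
      have len': "length l = i" "length q = r - i"
        using l q by (auto simp: pos_chains_def)
      show "(rev (map uminus (take i (case x of (l, q) \<Rightarrow> rev (map uminus l) @ q))),
             drop i (case x of (l, q) \<Rightarrow> rev (map uminus l) @ q)) = x"
        by (simp add: x len' rev_map o_def)
      have l': "lex_less (- p) 0 \<and> \<bar>fst p\<bar> < int M" if "p \<in> set l" for p
        using l that by (auto simp: pos_chains_def lex_less_def)
      have q': "lex_less 0 p \<and> \<bar>fst p\<bar> < int M" if "p \<in> set q" for p
        using q that by (auto simp: pos_chains_def lex_less_def)
      have lq: "lex_less (- p) p'" if "p \<in> set l" "p' \<in> set q" for p p'
        using l'[OF that(1)] q'[OF that(2)] lex_less_trans by blast
      have "sorted_wrt lex_less (rev (map uminus l))"
        using l lex_less_diff_left[of 0] by (simp add: pos_chains_def sorted_wrt_rev sorted_wrt_map)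
      then show "(case x of (l, q) \<Rightarrow> rev (map uminus l) @ q) \<in> E i"
        using l q i l' q' lq len'
        by (auto simp: x E_def all_chains_def pos_chains_def sorted_wrt_append)
      have "weight (take i ns) (rev (map uminus l)) = (-1) ^ sum_list (take i ns) * weight ?l l"
        by (rule weight_reflect) (use len' i len in simp)
      then show "weight ns (case x of (l, q) \<Rightarrow> rev (map uminus l) @ q) =
          (-1) ^ sum_list (take i ns) * (case x of (l, q) \<Rightarrow> weight ?l l * weight ?q q)"
        using weight_append[of "take i ns" "rev (map uminus l)" ?q q] len' i len
        by (simp add: x)
    next
      fix ps assume ps: "ps \<in> E i"
      show "(case (rev (map uminus (take i ps)), drop i ps) of (l, q) \<Rightarrow> rev (map uminus l) @ q) = ps"
        by (simp add: rev_map o_def)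
      have len': "length ps = r" and sorted: "sorted_wrt lex_less (take i ps @ drop i ps)"
        and bound: "\<forall>p\<in>set ps. \<bar>fst p\<bar> < int M"
        using ps by (auto simp: E_def all_chains_def)
      have "sorted_wrt lex_less (rev (map uminus (take i ps)))"
        using sorted lex_less_diff_left[of 0] by (simp add: sorted_wrt_append sorted_wrt_rev sorted_wrt_map)
      moreover have "lex_less 0 (- p) \<and> - fst p < int M" if "p \<in> set (take i ps)" for p
        using ps that bound in_set_takeD[OF that] by (force simp: E_def lex_less_def)
      moreover have "lex_less 0 p \<and> fst p < int M" if "p \<in> set (drop i ps)" for p
        using ps that bound in_set_dropD[OF that] by (force simp: E_def)
      ultimately show "(rev (map uminus (take i ps)), drop i ps) \<in> ?P \<times> ?Q"
        using len' i sorted by (auto simp: pos_chains_def sorted_wrt_append)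
    qed simp
    finally show "(weight ns has_sum v i) (E i)" .
  next
    fix i j assume "i \<in> {..r}" "j \<in> {..r}" "i \<noteq> j"
    have False if "ps \<in> E i" "ps \<in> E j" "i < j" "j \<le> r" for ps i j
    proof -
      have len: "length ps = r" using that by (simp add: E_def all_chains_def)
      have "drop i ps = ps ! i # drop (Suc i) ps"
        using that len by (simp add: Cons_nth_drop_Suc)
      then have "ps ! i \<in> set (drop i ps)" by simp
      moreover have "ps ! i \<in> set (take j ps)"
        using that len nth_mem[of i "take j ps"] by simp
      ultimately have "lex_less 0 (ps ! i)" "lex_less (ps ! i) 0"
        using that by (auto simp: E_def)
      then show False using lex_less_trans lex_less_irrefl by blast
    qed
    then show "E i \<inter> E j = {}"
      using \<open>i \<in> {..r}\<close> \<open>j \<in> {..r}\<close> \<open>i \<noteq> j\<close> by (metis atMost_iff disjoint_iff nat_neq_iff)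
  qed simp
  also have "?this \<longleftrightarrow> (weight ns has_sum (\<Sum>i\<le>r. v i)) (all_chains r M)"
  proof (rule has_sum_cong_neutral)
    fix ps assume ps: "ps \<in> all_chains r M - (\<Union>i\<le>r. E i)"
    have "0 \<in> set ps"
    proof (rule ccontr)
      assume nz: "0 \<notin> set ps"
      define i where "i = length (takeWhile (\<lambda>p. lex_less p 0) ps)"
      have tk: "take i ps = takeWhile (\<lambda>p. lex_less p 0) ps"
        and dr: "drop i ps = dropWhile (\<lambda>p. lex_less p 0) ps"
        unfolding i_def by (rule takeWhile_eq_take[symmetric], rule dropWhile_eq_drop[symmetric])
      have "lex_less 0 p" if "p \<in> set (drop i ps)" for p
      proof (cases "drop i ps")
        case (Cons x xs)
        have "sorted_wrt lex_less (x # xs)"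
          using ps unfolding Cons[symmetric] by (auto simp: all_chains_def sorted_wrt_drop)
        moreover have "\<not> lex_less x 0"
          using hd_dropWhile[of "\<lambda>p. lex_less p 0" ps, folded dr, unfolded Cons] by simp
        moreover have "x \<in> set ps"
          using Cons in_set_dropD[of x i ps] by simp
        ultimately have "lex_less 0 x" "p = x \<or> lex_less x p"
          using nz lex_less_linear[of x 0] that by (auto simp: Cons)
        then show ?thesis using lex_less_trans by blast
      qed (use that in simp)
      then have "ps \<in> E i"
        using ps by (auto simp: E_def tk dest: set_takeWhileD)
      moreover have "i \<le> r"
        using ps length_takeWhile_le[of "\<lambda>p. lex_less p 0" ps] by (simp add: i_def all_chains_def)
      ultimately show False using ps by blast
    qed
    then obtain j where j: "j < length ps" "ps ! j = 0"
      by (auto simp: in_set_conv_nth)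
    then have "(ns ! j \<ge> 2)" using ps ns len by (auto simp: all_chains_def)
    then have "(\<Prod>j<length ns. 1 / point (ps ! j) ^ (ns ! j)) = 0"
      using j ps len by (intro prod_zero) (auto simp: all_chains_def intro!: bexI[of _ j])
    then show "weight ns ps = 0"
      using ps len by (subst weight_eq_prod) (auto simp: all_chains_def)
  qed (auto simp: E_def)
  finally show ?thesis unfolding v_def .
qed

section \<open>The identity for a strip and its limit\<close>

lemma residue_identity_chain:
  assumes r: "r \<ge> 1" and len: "length ks = r"
    and ks: "\<forall>j<r. ks ! j \<ge> 2" and k: "k = (\<Sum>j<r. ks ! j)" and m: "m > 0"
    and ps: "ps \<in> all_chains r M"
  shows "(\<Sum>i<r. \<Sum>ns\<in>weak_compositions r (m + k).
            (-1) ^ (ks ! i + ns ! i) * binom1 (ns ! i) m *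
            (\<Prod>j\<in>{..<r} - {i}. binom1 (ns ! j) (ks ! j - 1)) * centred_term ns i ps)
       = (-1) ^ m *
         ((\<Sum>ns\<in>weak_compositions r (m + k).
             (\<Prod>j<r. binom1 (ns ! j) (ks ! j - 1)) * weight ns ps)
        + (\<Sum>i<r. \<Sum>ns | ns \<in> weak_compositions r (m + k) \<and> ns ! i = 0.
             (-1) ^ (ks ! i) * (\<Prod>j\<in>{..<r} - {i}. binom1 (ns ! j) (ks ! j - 1)) *
             zero_term ns i ps))"
proof -
  have len_ps: "length ps = r" and sorted: "sorted_wrt lex_less ps"
    using ps by (auto simp: all_chains_def)
  have "distinct ps"
    using sorted by (induction ps) auto
  then have dist: "distinct (map point ps)"
    using inj_on_subset[OF inj_point subset_UNIV] by (simp add: distinct_map)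
  have len_ns: "length ns = r" if "ns \<in> weak_compositions r (m + k)" for ns
    using that by (simp add: weak_compositions_def)
  have 1: "centred_term ns i ps = (\<Prod>j\<in>{..<r} - {i}.
      1 / (map point ps ! j - map point ps ! i) ^ (ns ! j)) / (map point ps ! i) ^ (ns ! i)"
    if "i < r" "length ns = r" for i ns
    using that len_ps
    by (simp add: centred_term_def weight_eq_prod prod_minus_index point_diff)
  have 2: "weight ns ps = (\<Prod>j<r. 1 / (map point ps ! j) ^ (ns ! j))" if "length ns = r" for ns
    using that len_ps by (simp add: weight_eq_prod)
  have 3: "zero_term ns i ps = (if map point ps ! i = 0
      then \<Prod>j\<in>{..<r} - {i}. 1 / (map point ps ! j) ^ (ns ! j) else 0)"
    if "i < r" "length ns = r" for i ns
    using that len_ps by (simp add: zero_term_def weight_eq_prod prod_minus_index)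
  show ?thesis
  proof (rule box_equals[OF residue_identity[OF r len _ ks k m dist]])
    show "length (map point ps) = r" using len_ps by simp
  next
    show "(\<Sum>i<r. \<Sum>ns\<in>weak_compositions r (m + k).
            (-1) ^ (ks ! i + ns ! i) * binom1 (ns ! i) m *
            (\<Prod>j\<in>{..<r} - {i}. binom1 (ns ! j) (ks ! j - 1)) *
            ((\<Prod>j\<in>{..<r} - {i}. 1 / (map point ps ! j - map point ps ! i) ^ (ns ! j)) / (map point ps ! i) ^ (ns ! i)))
        = (\<Sum>i<r. \<Sum>ns\<in>weak_compositions r (m + k).
            (-1) ^ (ks ! i + ns ! i) * binom1 (ns ! i) m *
            (\<Prod>j\<in>{..<r} - {i}. binom1 (ns ! j) (ks ! j - 1)) * centred_term ns i ps)"
      by (intro sum.cong refl) (simp only: 1 len_ns lessThan_iff)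
  next
    have "(\<Sum>ns\<in>weak_compositions r (m + k).
             (\<Prod>j<r. binom1 (ns ! j) (ks ! j - 1)) * (\<Prod>j<r. 1 / (map point ps ! j) ^ (ns ! j)))
        = (\<Sum>ns\<in>weak_compositions r (m + k). (\<Prod>j<r. binom1 (ns ! j) (ks ! j - 1)) * weight ns ps)"
      by (intro sum.cong refl) (simp only: 2 len_ns)
    moreover have "(\<Sum>i<r. \<Sum>ns | ns \<in> weak_compositions r (m + k) \<and> ns ! i = 0.
             (-1) ^ (ks ! i) * (\<Prod>j\<in>{..<r} - {i}. binom1 (ns ! j) (ks ! j - 1)) *
             (if map point ps ! i = 0 then \<Prod>j\<in>{..<r} - {i}. 1 / (map point ps ! j) ^ (ns ! j) else 0))
        = (\<Sum>i<r. \<Sum>ns | ns \<in> weak_compositions r (m + k) \<and> ns ! i = 0.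
             (-1) ^ (ks ! i) * (\<Prod>j\<in>{..<r} - {i}. binom1 (ns ! j) (ks ! j - 1)) * zero_term ns i ps)"
      by (intro sum.cong refl) (simp only: 3 len_ns lessThan_iff mem_Collect_eq)
    ultimately show "(-1) ^ m * ((\<Sum>ns\<in>weak_compositions r (m + k).
             (\<Prod>j<r. binom1 (ns ! j) (ks ! j - 1)) * (\<Prod>j<r. 1 / (map point ps ! j) ^ (ns ! j)))
        + (\<Sum>i<r. \<Sum>ns | ns \<in> weak_compositions r (m + k) \<and> ns ! i = 0.
             (-1) ^ (ks ! i) * (\<Prod>j\<in>{..<r} - {i}. binom1 (ns ! j) (ks ! j - 1)) *
             (if map point ps ! i = 0 then \<Prod>j\<in>{..<r} - {i}. 1 / (map point ps ! j) ^ (ns ! j) else 0)))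
       = (-1) ^ m * ((\<Sum>ns\<in>weak_compositions r (m + k). (\<Prod>j<r. binom1 (ns ! j) (ks ! j - 1)) * weight ns ps)
        + (\<Sum>i<r. \<Sum>ns | ns \<in> weak_compositions r (m + k) \<and> ns ! i = 0.
             (-1) ^ (ks ! i) * (\<Prod>j\<in>{..<r} - {i}. binom1 (ns ! j) (ks ! j - 1)) * zero_term ns i ps))"
      by (simp only:)
  qed
qed

text \<open>The sum of \<open>residue_identity_chain\<close> over all chains in a strip. The hypothesis \<open>M \<ge> 1\<close> puts \<open>0\<close> into the strip.\<close>
lemma chain_sums_identity:
  assumes r: "r \<ge> 1" and len: "length ks = r"
    and ks: "\<forall>j<r. ks ! j \<ge> 2" and k: "k = (\<Sum>j<r. ks ! j)" and m: "m > 0" and M: "M \<ge> 1"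
  shows "(\<Sum>i<r. \<Sum>ns\<in>weak_compositions r (m + k).
            (-1) ^ (ks ! i + ns ! i) * binom1 (ns ! i) m *
            (\<Prod>j\<in>{..<r} - {i}. binom1 (ns ! j) (ks ! j - 1)) *
            ((-1) ^ sum_list (take i ns) * (\<Sum>a | \<bar>a\<bar> < int M. row_total (ns ! i) a *
              (pos_sum (rev (take i ns)) (nat (int M + a)) * pos_sum (drop (Suc i) ns) (nat (int M - a))))))
       = (-1) ^ m *
         ((\<Sum>ns\<in>weak_compositions r (m + k).
             (\<Prod>j<r. binom1 (ns ! j) (ks ! j - 1)) *
             (\<Sum>i\<le>r. (-1) ^ sum_list (take i ns) * (pos_sum (rev (take i ns)) M * pos_sum (drop i ns) M)))
        + (\<Sum>i<r. \<Sum>ns | ns \<in> weak_compositions r (m + k) \<and> ns ! i = 0.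
             (-1) ^ (ks ! i) * (\<Prod>j\<in>{..<r} - {i}. binom1 (ns ! j) (ks ! j - 1)) *
             ((-1) ^ sum_list (take i ns) * (pos_sum (rev (take i ns)) M * pos_sum (drop (Suc i) ns) M))))"
    (is "?V1 = (-1) ^ m * (?V2 + ?V3)")
proof -
  \<comment> \<open>If the coefficient \<open>c\<close> vanishes, nothing is known about the convergence of \<open>f\<close>.\<close>
  have cmult: "((\<lambda>ps. c * f ps) has_sum (c * s)) A" if "c \<noteq> 0 \<Longrightarrow> (f has_sum s) A"
    for c s :: complex and f and A :: "(int \<times> int) list set"
    using that by (cases "c = 0") (auto intro: has_sum_cmult_right)
  have len_ns: "length ns = r" if "ns \<in> weak_compositions r (m + k)" for ns
    using that by (simp add: weak_compositions_def)
  have others: "ns ! j \<ge> 2"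
    if "(\<Prod>j\<in>{..<r} - {i}. binom1 (ns ! j) (ks ! j - 1)) \<noteq> 0" "j < r" "j \<noteq> i" for ns i j
    using that ks by (intro prod_binom1_neq_0_imp[OF that(1)]) auto
  have V1: "((\<lambda>ps. \<Sum>i<r. \<Sum>ns\<in>weak_compositions r (m + k).
            (-1) ^ (ks ! i + ns ! i) * binom1 (ns ! i) m *
            (\<Prod>j\<in>{..<r} - {i}. binom1 (ns ! j) (ks ! j - 1)) * centred_term ns i ps) has_sum ?V1)
          (all_chains r M)"
  proof (intro has_sum_sum cmult centred_term_has_sum ballI)
    fix i ns n
    assume i: "i \<in> {..<r}" and ns: "ns \<in> weak_compositions r (m + k)" and n: "n \<in> set ns"
      and c: "(-1) ^ (ks ! i + ns ! i) * binom1 (ns ! i) m *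
            (\<Prod>j\<in>{..<r} - {i}. binom1 (ns ! j) (ks ! j - 1)) \<noteq> 0"
    obtain j where j: "j < r" "n = ns ! j"
      using n len_ns[OF ns] by (auto simp: in_set_conv_nth)
    show "n \<ge> 2"
      using c others[of ns i j] binom1_neq_0_imp[of "ns ! i" m] m j by (cases "j = i") auto
  qed (use len_ns in auto)
  have V2: "((\<lambda>ps. \<Sum>ns\<in>weak_compositions r (m + k).
             (\<Prod>j<r. binom1 (ns ! j) (ks ! j - 1)) * weight ns ps) has_sum ?V2) (all_chains r M)"
  proof (intro has_sum_sum cmult weight_has_sum_all_chains ballI)
    fix ns n
    assume ns: "ns \<in> weak_compositions r (m + k)" and n: "n \<in> set ns"
      and c: "(\<Prod>j<r. binom1 (ns ! j) (ks ! j - 1)) \<noteq> 0"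
    obtain j where j: "j < r" "n = ns ! j"
      using n len_ns[OF ns] by (auto simp: in_set_conv_nth)
    then show "n \<ge> 2"
      using prod_binom1_neq_0_imp[OF c, of j] ks by auto
  qed (use len_ns in auto)
  have V3: "((\<lambda>ps. \<Sum>i<r. \<Sum>ns | ns \<in> weak_compositions r (m + k) \<and> ns ! i = 0.
             (-1) ^ (ks ! i) * (\<Prod>j\<in>{..<r} - {i}. binom1 (ns ! j) (ks ! j - 1)) *
             zero_term ns i ps) has_sum ?V3) (all_chains r M)"
  proof (intro has_sum_sum cmult zero_term_has_sum)
    fix i ns
    assume i: "i \<in> {..<r}" and ns: "ns \<in> {ns. ns \<in> weak_compositions r (m + k) \<and> ns ! i = 0}"
      and c: "(-1) ^ (ks ! i) * (\<Prod>j\<in>{..<r} - {i}. binom1 (ns ! j) (ks ! j - 1)) \<noteq> 0"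
    have nz: "(\<Prod>j\<in>{..<r} - {i}. binom1 (ns ! j) (ks ! j - 1)) \<noteq> 0"
      using c by auto
    have l: "length ns = r" using ns len_ns by blast
    have "i < r" using i by simp
    from all_set_take_drop[OF l this, of "\<lambda>n. n \<ge> 2"] others[OF nz]
    show "\<forall>n\<in>set (take i ns). n \<ge> 2" "\<forall>n\<in>set (drop (Suc i) ns). n \<ge> 2"
      by blast+
  qed (use len_ns M in auto)
  have "?V1 = infsum (\<lambda>ps. (-1) ^ m *
         ((\<Sum>ns\<in>weak_compositions r (m + k).
             (\<Prod>j<r. binom1 (ns ! j) (ks ! j - 1)) * weight ns ps)
        + (\<Sum>i<r. \<Sum>ns | ns \<in> weak_compositions r (m + k) \<and> ns ! i = 0.
             (-1) ^ (ks ! i) * (\<Prod>j\<in>{..<r} - {i}. binom1 (ns ! j) (ks ! j - 1)) *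
             zero_term ns i ps))) (all_chains r M)"
    unfolding infsumI[OF V1, symmetric]
    by (rule infsum_cong) (rule residue_identity_chain[OF r len ks k m])
  also have "\<dots> = (-1) ^ m * (?V2 + ?V3)"
    by (rule infsumI[OF has_sum_cmult_right[OF has_sum_add[OF V2 V3]]])
  finally show ?thesis .
qed

lemma row_convolution_tendsto:
  assumes n: "n \<ge> 2" and l: "\<forall>k\<in>set ls. k \<ge> 2" and q: "\<forall>k\<in>set qs. k \<ge> 2"
  shows "(\<lambda>M. \<Sum>a | \<bar>a\<bar> < int M. row_total n a *
            (pos_sum ls (nat (int M + a)) * pos_sum qs (nat (int M - a))))
         \<longlonglongrightarrow> eisenstein \<tau> n * (multi_eisenstein \<tau> ls * multi_eisenstein \<tau> qs)"
proof -
  obtain B where B: "\<And>K. norm (pos_sum ls K) \<le> B"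
    using convergent_imp_Bseq[OF pos_sum_convergent[OF l]] Bseq_def by metis
  obtain C where C: "\<And>K. norm (pos_sum qs K) \<le> C"
    using convergent_imp_Bseq[OF pos_sum_convergent[OF q]] Bseq_def by metis
  have "B \<ge> 0" using B[of 0] norm_ge_zero order_trans by blast
  show ?thesis
    unfolding eisenstein_eq_infsum_row_total[OF n]
  proof (rule tannery_symmetric_int[where B = "B * C", OF row_total_abs_summable[OF n]])
    fix a :: int
    show "(\<lambda>M. pos_sum ls (nat (int M + a)) * pos_sum qs (nat (int M - a)))
        \<longlonglongrightarrow> multi_eisenstein \<tau> ls * multi_eisenstein \<tau> qs"
      using filterlim_nat_int_shift[of a] filterlim_nat_int_shift[of "- a"]
      by (intro tendsto_mult filterlim_compose[OF pos_sum_tendsto] l q) simp_all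
    show "norm (pos_sum ls (nat (int M + a)) * pos_sum qs (nat (int M - a))) \<le> B * C" for M
      using \<open>B \<ge> 0\<close> by (simp add: norm_mult mult_mono B C)
  qed
qed

text \<open>The limit of \<open>chain_sums_identity\<close>. It agrees with the theorem below up to the factor \<open>(-1) ^ (m + k)\<close>.\<close>
lemma eisenstein_identity:
  assumes r: "r \<ge> 1" and len: "length ks = r"
    and ks: "\<forall>j<r. ks ! j \<ge> 2" and k: "k = (\<Sum>j<r. ks ! j)" and m: "m > 0"
  shows "(\<Sum>i<r. \<Sum>ns\<in>weak_compositions r (m + k).
            (-1) ^ (ks ! i + ns ! i) * binom1 (ns ! i) m *
            (\<Prod>j\<in>{..<r} - {i}. binom1 (ns ! j) (ks ! j - 1)) *
            ((-1) ^ sum_list (take i ns) * (eisenstein \<tau> (ns ! i) *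
              (multi_eisenstein \<tau> (rev (take i ns)) * multi_eisenstein \<tau> (drop (Suc i) ns)))))
       = (-1) ^ m *
         ((\<Sum>ns\<in>weak_compositions r (m + k).
             (\<Prod>j<r. binom1 (ns ! j) (ks ! j - 1)) *
             (\<Sum>i\<le>r. (-1) ^ sum_list (take i ns) *
               (multi_eisenstein \<tau> (rev (take i ns)) * multi_eisenstein \<tau> (drop i ns))))
        + (\<Sum>i<r. \<Sum>ns | ns \<in> weak_compositions r (m + k) \<and> ns ! i = 0.
             (-1) ^ (ks ! i) * (\<Prod>j\<in>{..<r} - {i}. binom1 (ns ! j) (ks ! j - 1)) *
             ((-1) ^ sum_list (take i ns) *
               (multi_eisenstein \<tau> (rev (take i ns)) * multi_eisenstein \<tau> (drop (Suc i) ns)))))"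
    (is "?V1 = ?V")
proof (rule LIMSEQ_unique)
  \<comment> \<open>If the coefficient \<open>c\<close> vanishes, nothing is known about the convergence of \<open>f\<close>.\<close>
  have cmult: "(\<lambda>M. c * f M) \<longlonglongrightarrow> c * s" if "c \<noteq> 0 \<Longrightarrow> f \<longlonglongrightarrow> s"
    for c s :: complex and f
    using that by (cases "c = 0") (auto intro: tendsto_mult_left)
  have len_ns: "length ns = r" if "ns \<in> weak_compositions r (m + k)" for ns
    using that by (simp add: weak_compositions_def)
  have others: "ns ! j \<ge> 2"
    if "(\<Prod>j\<in>{..<r} - {i}. binom1 (ns ! j) (ks ! j - 1)) \<noteq> 0" "j < r" "j \<noteq> i" for ns i j
    using that ks by (intro prod_binom1_neq_0_imp[OF that(1)]) auto
  have around: "(\<forall>n\<in>set (rev (take i ns)). n \<ge> 2) \<and> (\<forall>n\<in>set (drop (Suc i) ns). n \<ge> 2)"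
    if "(\<Prod>j\<in>{..<r} - {i}. binom1 (ns ! j) (ks ! j - 1)) \<noteq> 0" "i < r"
       "ns \<in> weak_compositions r (m + k)" for ns i
    using all_set_take_drop[OF len_ns[OF that(3)] that(2), of "\<lambda>n. n \<ge> 2"] others[OF that(1)]
    by simp
  let ?l = "\<lambda>M. \<Sum>i<r. \<Sum>ns\<in>weak_compositions r (m + k).
            (-1) ^ (ks ! i + ns ! i) * binom1 (ns ! i) m *
            (\<Prod>j\<in>{..<r} - {i}. binom1 (ns ! j) (ks ! j - 1)) *
            ((-1) ^ sum_list (take i ns) * (\<Sum>a | \<bar>a\<bar> < int M. row_total (ns ! i) a *
              (pos_sum (rev (take i ns)) (nat (int M + a)) * pos_sum (drop (Suc i) ns) (nat (int M - a)))))"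
  let ?r = "\<lambda>M. (-1) ^ m *
         ((\<Sum>ns\<in>weak_compositions r (m + k).
             (\<Prod>j<r. binom1 (ns ! j) (ks ! j - 1)) *
             (\<Sum>i\<le>r. (-1) ^ sum_list (take i ns) * (pos_sum (rev (take i ns)) M * pos_sum (drop i ns) M)))
        + (\<Sum>i<r. \<Sum>ns | ns \<in> weak_compositions r (m + k) \<and> ns ! i = 0.
             (-1) ^ (ks ! i) * (\<Prod>j\<in>{..<r} - {i}. binom1 (ns ! j) (ks ! j - 1)) *
             ((-1) ^ sum_list (take i ns) * (pos_sum (rev (take i ns)) M * pos_sum (drop (Suc i) ns) M))))"
  have "?r \<longlonglongrightarrow> ?V"
  proof (rule tendsto_mult_left, rule tendsto_add; intro tendsto_sum cmult)
    fix ns i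
    assume ns: "ns \<in> weak_compositions r (m + k)"
      and c: "(\<Prod>j<r. binom1 (ns ! j) (ks ! j - 1)) \<noteq> 0"
    have "\<forall>n\<in>set ns. n \<ge> 2"
      using prod_binom1_neq_0_imp[OF c] ks len_ns[OF ns] by (auto simp: in_set_conv_nth)
    then show "(\<lambda>M. pos_sum (rev (take i ns)) M * pos_sum (drop i ns) M)
        \<longlonglongrightarrow> multi_eisenstein \<tau> (rev (take i ns)) * multi_eisenstein \<tau> (drop i ns)"
      by (intro tendsto_mult pos_sum_tendsto) (auto dest: in_set_takeD in_set_dropD)
  next
    fix ns i
    assume i: "i \<in> {..<r}" and ns: "ns \<in> {ns. ns \<in> weak_compositions r (m + k) \<and> ns ! i = 0}"
      and c: "(-1) ^ (ks ! i) * (\<Prod>j\<in>{..<r} - {i}. binom1 (ns ! j) (ks ! j - 1)) \<noteq> 0"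
    then have "(\<forall>n\<in>set (rev (take i ns)). n \<ge> 2) \<and> (\<forall>n\<in>set (drop (Suc i) ns). n \<ge> 2)"
      by (intro around) auto
    then show "(\<lambda>M. pos_sum (rev (take i ns)) M * pos_sum (drop (Suc i) ns) M)
        \<longlonglongrightarrow> multi_eisenstein \<tau> (rev (take i ns)) * multi_eisenstein \<tau> (drop (Suc i) ns)"
      by (intro tendsto_mult pos_sum_tendsto) auto
  qed
  moreover have "eventually (\<lambda>M. ?r M = ?l M) at_top"
    using eventually_ge_at_top[of 1]
    by eventually_elim (rule chain_sums_identity[OF r len ks k m, symmetric])
  ultimately show "?l \<longlonglongrightarrow> ?V"
    by (rule Lim_transform_eventually)
  show "?l \<longlonglongrightarrow> ?V1"
  proof (intro tendsto_sum cmult row_convolution_tendsto)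
    fix i ns
    assume i: "i \<in> {..<r}" and ns: "ns \<in> weak_compositions r (m + k)"
      and c: "(-1) ^ (ks ! i + ns ! i) * binom1 (ns ! i) m *
            (\<Prod>j\<in>{..<r} - {i}. binom1 (ns ! j) (ks ! j - 1)) \<noteq> 0"
    show "ns ! i \<ge> 2"
      using binom1_neq_0_imp[of "ns ! i" m] c m by auto
    have "(\<forall>n\<in>set (rev (take i ns)). n \<ge> 2) \<and> (\<forall>n\<in>set (drop (Suc i) ns). n \<ge> 2)"
      using c i ns by (intro around) auto
    then show "\<forall>n\<in>set (rev (take i ns)). n \<ge> 2" "\<forall>n\<in>set (drop (Suc i) ns). n \<ge> 2"
      by blast+
  qed
qed

end

theorem corollary4p5:
  fixes \<tau> :: complex and r m k :: nat and ks :: "nat list"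
  assumes "Im \<tau> > 0"
    and "r \<ge> 1"
    and "length ks = r"
    and "\<forall>j<r. ks ! j \<ge> 2"
    and "k = (\<Sum>j<r. ks ! j)"
    and "m > 0"
  shows
    "(\<Sum>i<r. \<Sum>ns\<in>weak_compositions r (m + k).
        (-1) ^ (ks ! i + sum_list (drop (Suc i) ns)) *
        binom1 (ns ! i) m * (\<Prod>j\<in>{..<r} - {i}. binom1 (ns ! j) (ks ! j - 1)) *
        multi_eisenstein \<tau> (rev (take i ns)) * multi_eisenstein \<tau> (drop (Suc i) ns) *
        eisenstein \<tau> (ns ! i))
     = (\<Sum>i\<le>r. \<Sum>ns\<in>weak_compositions r (m + k).
          (-1) ^ (sum_list (drop i ns) + m) *
          (\<Prod>j<r. binom1 (ns ! j) (ks ! j - 1)) *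
          multi_eisenstein \<tau> (rev (take i ns)) * multi_eisenstein \<tau> (drop i ns))
     + (\<Sum>i<r. \<Sum>ns | ns \<in> weak_compositions r (m + k) \<and> ns ! i = 0.
          (-1) ^ (ks ! i + sum_list (drop (Suc i) ns) + m) *
          (\<Prod>j\<in>{..<r} - {i}. binom1 (ns ! j) (ks ! j - 1)) *
          multi_eisenstein \<tau> (rev (take i ns)) * multi_eisenstein \<tau> (drop (Suc i) ns))"
    (is "?L = ?R1 + ?R2")
proof -
  interpret upper_half_point \<tau>
    by unfold_locales fact
  \<comment> \<open>All indices of a composition add up to \<open>m + k\<close>. This turns the sign of the indices before \<open>i\<close> into that of the indices after \<open>i\<close>.\<close>
  have split: "sum_list (take i ns) + sum_list (drop i ns) = m + k"
    if "ns \<in> weak_compositions r (m + k)" for i ns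
    using that by (simp add: weak_compositions_def flip: sum_list_append)
  have drop: "sum_list (drop i ns) = ns ! i + sum_list (drop (Suc i) ns)"
    if "ns \<in> weak_compositions r (m + k)" "i < r" for i ns
    using that by (subst Cons_nth_drop_Suc[symmetric]) (auto simp: weak_compositions_def)
  have sign: "(-1) ^ x = ((-1) ^ y :: complex)" if "even (x + y)" for x y :: nat
    using that by (simp add: minus_one_power_iff)
  have "?L = (-1) ^ (m + k) * (\<Sum>i<r. \<Sum>ns\<in>weak_compositions r (m + k).
            (-1) ^ (ks ! i + ns ! i) * binom1 (ns ! i) m *
            (\<Prod>j\<in>{..<r} - {i}. binom1 (ns ! j) (ks ! j - 1)) *
            ((-1) ^ sum_list (take i ns) * (eisenstein \<tau> (ns ! i) *
              (multi_eisenstein \<tau> (rev (take i ns)) * multi_eisenstein \<tau> (drop (Suc i) ns)))))"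
    unfolding sum_distrib_left
  proof (intro sum.cong refl)
    fix i ns assume i: "i \<in> {..<r}" and ns: "ns \<in> weak_compositions r (m + k)"
    have "(-1) ^ (ks ! i + sum_list (drop (Suc i) ns))
        = ((-1) ^ (m + k + (ks ! i + ns ! i) + sum_list (take i ns)) :: complex)"
      by (rule sign, subst split[OF ns, of i, symmetric]) (use drop[OF ns, of i] i in auto)
    then show "(-1) ^ (ks ! i + sum_list (drop (Suc i) ns)) *
        binom1 (ns ! i) m * (\<Prod>j\<in>{..<r} - {i}. binom1 (ns ! j) (ks ! j - 1)) *
        multi_eisenstein \<tau> (rev (take i ns)) * multi_eisenstein \<tau> (drop (Suc i) ns) *
        eisenstein \<tau> (ns ! i) = (-1) ^ (m + k) * ((-1) ^ (ks ! i + ns ! i) * binom1 (ns ! i) m *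
            (\<Prod>j\<in>{..<r} - {i}. binom1 (ns ! j) (ks ! j - 1)) *
            ((-1) ^ sum_list (take i ns) * (eisenstein \<tau> (ns ! i) *
              (multi_eisenstein \<tau> (rev (take i ns)) * multi_eisenstein \<tau> (drop (Suc i) ns)))))"
      by (simp only: power_add[of _ _ "sum_list (take i ns)"] power_add[of _ "m + k"] mult_ac)
  qed
  moreover have "?R1 = (-1) ^ (m + k) * ((-1) ^ m * (\<Sum>ns\<in>weak_compositions r (m + k).
             (\<Prod>j<r. binom1 (ns ! j) (ks ! j - 1)) *
             (\<Sum>i\<le>r. (-1) ^ sum_list (take i ns) *
               (multi_eisenstein \<tau> (rev (take i ns)) * multi_eisenstein \<tau> (drop i ns)))))"
    unfolding sum_distrib_left
  proof (subst sum.swap, intro sum.cong refl)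
    fix i ns assume ns: "ns \<in> weak_compositions r (m + k)"
    have "(-1) ^ (sum_list (drop i ns) + m) = ((-1) ^ (m + k + m + sum_list (take i ns)) :: complex)"
      by (rule sign, subst split[OF ns, of i, symmetric]) auto
    then show "(-1) ^ (sum_list (drop i ns) + m) * (\<Prod>j<r. binom1 (ns ! j) (ks ! j - 1)) *
          multi_eisenstein \<tau> (rev (take i ns)) * multi_eisenstein \<tau> (drop i ns) =
        (-1) ^ (m + k) * ((-1) ^ m * ((\<Prod>j<r. binom1 (ns ! j) (ks ! j - 1)) *
             ((-1) ^ sum_list (take i ns) *
               (multi_eisenstein \<tau> (rev (take i ns)) * multi_eisenstein \<tau> (drop i ns)))))"
      by (simp only: power_add[of _ _ "sum_list (take i ns)"] power_add[of _ "m + k"] mult_ac)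
  qed
  moreover have "?R2 = (-1) ^ (m + k) * ((-1) ^ m * (\<Sum>i<r. \<Sum>ns | ns \<in> weak_compositions r (m + k) \<and> ns ! i = 0.
             (-1) ^ (ks ! i) * (\<Prod>j\<in>{..<r} - {i}. binom1 (ns ! j) (ks ! j - 1)) *
             ((-1) ^ sum_list (take i ns) *
               (multi_eisenstein \<tau> (rev (take i ns)) * multi_eisenstein \<tau> (drop (Suc i) ns)))))"
    unfolding sum_distrib_left
  proof (intro sum.cong refl)
    fix i ns assume i: "i \<in> {..<r}"
      and "ns \<in> {ns. ns \<in> weak_compositions r (m + k) \<and> ns ! i = 0}"
    then have ns: "ns \<in> weak_compositions r (m + k)" and 0: "ns ! i = 0" by auto
    have "(-1) ^ (ks ! i + sum_list (drop (Suc i) ns) + m)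
        = ((-1) ^ (m + k + (m + ks ! i) + sum_list (take i ns)) :: complex)"
      by (rule sign, subst split[OF ns, of i, symmetric]) (use drop[OF ns, of i] i 0 in auto)
    then show "(-1) ^ (ks ! i + sum_list (drop (Suc i) ns) + m) *
          (\<Prod>j\<in>{..<r} - {i}. binom1 (ns ! j) (ks ! j - 1)) *
          multi_eisenstein \<tau> (rev (take i ns)) * multi_eisenstein \<tau> (drop (Suc i) ns) =
        (-1) ^ (m + k) * ((-1) ^ m * ((-1) ^ (ks ! i) *
           (\<Prod>j\<in>{..<r} - {i}. binom1 (ns ! j) (ks ! j - 1)) *
             ((-1) ^ sum_list (take i ns) *
               (multi_eisenstein \<tau> (rev (take i ns)) * multi_eisenstein \<tau> (drop (Suc i) ns)))))"
      by (simp only: power_add[of _ _ "sum_list (take i ns)"] power_add[of _ "m + k"]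
            power_add[of _ m "ks ! i"] mult_ac)
  qed
  ultimately show ?thesis
    using eisenstein_identity[OF assms(2-6)] by (simp only: distrib_left)
qed

end
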